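(* Let $\Delta = \Delta(m)$ be a positive function of the positive integer $m$ with $\Delta(m) \to \infty$ as $m \to \infty$. For every small $\epsilon > 0$ the following holds. For every integer $m$, every integer $S$ and every real $N$ with $m^{1/(2-\epsilon)} \leq N \leq m$, the set $$\Big\{ xy \pmod m : x, y \in \mathbb{Z},\ \tfrac{N}{4} \leq x \leq N,\ S+1 \leq y \leq S + \Delta m^{1/2} \sqrt{\tfrac{m}{\phi(m)}} \log m,\ (x,y) = 1 \Big\}$$ contains $$\Big(1 + O_\epsilon(\Delta^{-1}) + O_\epsilon\Big(\frac{\Delta}{\log m} \sqrt{\frac{m}{\phi(m)}}\Big)\Big)\, m$$ residue classes modulo $m$.
   Context: $\phi$ is Euler's totient function. $O_\epsilon(g)$ denotes a quantity bounded in absolute value by $C_\epsilon g$, where the constant $C_\epsilon>0$ depends only on $\epsilon$ (in particular not on $m$, $N$, $S$). *)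

theory Defs
  imports Complex_Main "HOL-Number_Theory.Totient"
begin

text \<open>
  Residue classes modulo \<open>m\<close> are represented by their least nonnegative representatives, so that
  the cardinality of this set is the number of classes hit. The parameter \<open>D\<close> is the value
  \<open>\<Delta>(m)\<close>; neither \<open>x\<close> nor \<open>y\<close> is required to be coprime to \<open>m\<close>.
\<close>
definition coprime_product_residues :: "nat \<Rightarrow> real \<Rightarrow> int \<Rightarrow> real \<Rightarrow> int set" where
  "coprime_product_residues m N S D =
     {(x * y) mod int m | x y :: int.
        N / 4 \<le> real_of_int x \<and> real_of_int x \<le> N \<and>
        S + 1 \<le> y \<and>
        real_of_int y \<le> real_of_int S
          + D * real m powr (1 / 2) * sqrt (real m / real (totient m)) * ln (real m) \<and>
        coprime x y}"

end

theory Submission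
  imports Defs "HOL-Number_Theory.Number_Theory" "HOL-Real_Asymp.Real_Asymp"
    "HOL-Analysis.Convex" "HOL-Analysis.Harmonic_Numbers"
begin

text \<open>
  Write \<open>L\<close> for the length of the interval of the \<open>y\<close>, let \<open>X\<close> consist of about \<open>N / ln m\<close> primes
  \<open>x \<in> [N/4, N]\<close> not dividing \<open>m\<close>, and let \<open>B\<close> be the set of residues that are not of the form
  \<open>x * y\<close> with \<open>x \<in> X\<close>. For \<open>x \<in> X\<close> the set \<open>B / x\<close> misses an interval of length \<open>L\<close>. Testing this
  against \<open>|F|\<^sup>4 - \<tau> |F|\<^sup>2\<close>, where \<open>F\<close> is a geometric sum of length \<open>K\<close> about \<open>m / L\<close> and
  \<open>|F|\<^sup>2 \<le> \<tau>\<close> off the interval, bounds \<open>|B|\<close> by the Fourier coefficients of the indicator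
  of \<open>B\<close> at the frequencies \<open>h / x\<close> with \<open>0 < |h| < 2 K\<close>. A residue class contains \<open>O(1 + K N / m)\<close> of
  these frequencies because the slopes \<open>h / x\<close> within a class are well spaced, so Cauchy's
  inequality and Parseval's identity give \<open>|B| = O(m / \<Delta>)\<close>.
  Since \<open>x\<close> is prime, \<open>(x, y) = 1\<close> fails only if \<open>x\<close> divides \<open>y\<close>; such pairs number
  at most \<open>|X| (1 + 4 L / N) = O(m / ln m)\<close>.
\<close>

section \<open>Additive characters and an uncertainty inequality\<close>

definition add_char :: "nat \<Rightarrow> int \<Rightarrow> complex" where
  "add_char m t = cis (2 * pi * real_of_int t / real m)"

lemma add_char_add: "add_char m (a + b) = add_char m a * add_char m b"
  by (simp add: add_char_def cis_mult add_divide_distrib ring_distribs)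

lemma add_char_0 [simp]: "add_char m 0 = 1"
  by (simp add: add_char_def)

lemma norm_add_char [simp]: "cmod (add_char m a) = 1"
  by (simp add: add_char_def)

lemma cnj_add_char: "cnj (add_char m a) = add_char m (- a)"
  by (simp add: add_char_def cis_cnj)

lemma add_char_mult_nat: "add_char m (int j * a) = add_char m a ^ j"
  unfolding add_char_def Complex.DeMoivre by (simp add: mult_ac)

lemma add_char_dvd:
  assumes "m > 0" "int m dvd t"
  shows "add_char m t = 1"
proof -
  obtain k where "t = int m * k" using assms by auto
  then have "2 * pi * real_of_int t / real m = 2 * pi * real_of_int k"
    using assms by simp
  then show ?thesis unfolding add_char_def by (metis Ints_of_int cis_multiple_2pi)
qed

lemma add_char_mod:
  assumes "m > 0"
  shows "add_char m (t mod int m) = add_char m t"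
proof -
  have "add_char m t = add_char m (int m * (t div int m)) * add_char m (t mod int m)"
    by (simp flip: add_char_add)
  then show ?thesis using add_char_dvd[OF assms, of "int m * (t div int m)"] by simp
qed

lemma add_char_cong:
  assumes "m > 0" "[s = t] (mod int m)"
  shows "add_char m s = add_char m t"
  using assms add_char_mod[of m s] add_char_mod[of m t] by (simp add: Cong.cong_def)

text \<open>Taylor's bound gives sin x >= x - x^3 / 6, and x^2 < 3 on this range because pi / 2 <
  1.6. The constant 1/2 is weaker than Jordan's 2 / pi but suffices for chord lengths.\<close>

lemma sin_ge_half:
  fixes x :: real
  assumes "0 \<le> x" "x \<le> pi / 2"
  shows "x / 2 \<le> sin x"
proof -
  have "\<bar>sin x - (\<Sum>k<3. sin_coeff k * x ^ k)\<bar> \<le> inverse (fact 3) * \<bar>x\<bar> ^ 3"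
    by (rule Maclaurin_sin_bound)
  then have "\<bar>sin x - x\<bar> \<le> x ^ 3 / 6"
    using assms by (simp add: eval_nat_numeral sin_coeff_def)
  moreover have "x ^ 3 / 6 \<le> x / 2"
  proof -
    have "x \<le> 1.6" using assms pi_less_4 pi_approx by simp
    then have "x * x \<le> 1.6 * 1.6" using assms by (intro mult_mono) auto
    then have "x * (x * x) \<le> x * 3" using assms by (intro mult_left_mono) auto
    then show ?thesis by (simp add: power3_eq_cube)
  qed
  ultimately show ?thesis by linarith
qed

lemma norm_cis_minus_one: "cmod (cis (2 * t) - 1) = 2 * \<bar>sin t\<bar>"
proof -
  have "cis (2 * t) - 1 = cis t * (cis t - cis (- t))"
    by (simp add: cis_mult right_diff_distrib)
  also have "cis t - cis (- t) = 2 * \<i> * sin t"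
    by (simp add: complex_eq_iff)
  finally show ?thesis by (simp add: norm_mult)
qed

text \<open>The chord from 1 to e(u / m) has length 2 |sin (pi u / m)|. The residue of
  \<open>u\<close> keeps distance \<open>d\<close> from both 0 and \<open>m\<close>, so by the
  symmetry of sin about pi / 2 the sine is at least half of pi d / m; then pi >= 2.\<close>

lemma add_char_gap:
  fixes d :: real
  assumes "m > 0" "d > 0" "d \<le> u mod int m" "u mod int m \<le> m - d"
  shows "2 * d / m \<le> cmod (add_char m u - 1)"
proof -
  define q where "q = pi * d / m"
  define t where "t = pi * (u mod int m) / m"
  have "add_char m u = cis (2 * t)"
    by (subst add_char_mod[OF assms(1), symmetric]) (simp add: add_char_def t_def mult.assoc)
  then have 1: "cmod (add_char m u - 1) = 2 * \<bar>sin t\<bar>" by (simp add: norm_cis_minus_one)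
  have lo: "q \<le> t" unfolding t_def q_def
    using assms by (intro divide_right_mono mult_left_mono) auto
  have "t \<le> pi * (m - d) / m" unfolding t_def
    using assms by (intro divide_right_mono mult_left_mono) auto
  then have hi: "q \<le> pi - t" using assms by (simp add: q_def field_simps)
  have pos: "0 < q" using assms by (simp add: q_def)
  have "q / 2 \<le> sin t"
  proof (cases "t \<le> pi / 2")
    case True
    moreover have "0 \<le> t" using lo pos by linarith
    ultimately have "t / 2 \<le> sin t" by (intro sin_ge_half)
    then show ?thesis using lo by linarith
  next
    case False
    then show ?thesis using sin_ge_half[of "pi - t"] hi pos by simp
  qed
  moreover have "2 * d / m \<le> q"
    using mult_right_mono[of 2 pi "d / m"] pi_ge_two assms by (simp add: q_def field_simps)
  ultimately show ?thesis unfolding 1 by linarith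
qed

section \<open>The geometric sum and its even moments\<close>

definition dirichlet :: "nat \<Rightarrow> nat \<Rightarrow> int \<Rightarrow> complex" where
  "dirichlet m K u = (\<Sum>j<K. add_char m (int j * u))"

text \<open>In the closed form of the geometric sum the numerator is at most 2 and the denominator
  is controlled by \<open>add_char_gap\<close>. The bound is uniform in \<open>K\<close>.\<close>

lemma dirichlet_bound:
  fixes d :: real
  assumes "m > 0" "d > 0" "d \<le> u mod int m" "u mod int m \<le> m - d"
  shows "cmod (dirichlet m K u) \<le> m / d"
proof -
  let ?z = "add_char m u"
  have gap: "2 * d / m \<le> cmod (?z - 1)" by (rule add_char_gap[OF assms])
  then have ne: "?z \<noteq> 1" using assms by (auto simp: field_simps)
  have "dirichlet m K u = (?z ^ K - 1) / (?z - 1)"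
    unfolding dirichlet_def add_char_mult_nat using ne by (rule geometric_sum)
  also have "cmod \<dots> = cmod (?z ^ K - 1) / cmod (?z - 1)" by (simp add: norm_divide)
  also have "\<dots> \<le> 2 / (2 * d / m)"
    using norm_triangle_ineq4[of "?z ^ K" 1] gap assms
    by (intro frac_le) (auto simp: norm_power)
  finally show ?thesis using assms by simp
qed

lemma dirichlet_square:
  "complex_of_real ((cmod (dirichlet m K u))\<^sup>2) =
     (\<Sum>(i, j)\<in>{..<K} \<times> {..<K}. add_char m ((int i - int j) * u))"
proof -
  have "complex_of_real ((cmod (dirichlet m K u))\<^sup>2) = dirichlet m K u * cnj (dirichlet m K u)"
    by (rule complex_norm_square)
  also have "\<dots> = (\<Sum>i<K. \<Sum>j<K. add_char m (int i * u) * add_char m (- (int j * u)))"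
    by (simp add: dirichlet_def cnj_add_char sum_product)
  also have "\<dots> = (\<Sum>i<K. \<Sum>j<K. add_char m ((int i - int j) * u))"
    by (simp flip: add_char_add add: algebra_simps)
  finally show ?thesis by (simp add: sum.cartesian_product)
qed

section \<open>Counting index tuples by frequency\<close>

definition quads :: "nat \<Rightarrow> ((nat \<times> nat) \<times> nat \<times> nat) set" where
  "quads K = ({..<K} \<times> {..<K}) \<times> ({..<K} \<times> {..<K})"

definition freq2 :: "nat \<times> nat \<Rightarrow> int" where "freq2 = (\<lambda>(i, j). int i - int j)"

definition freq4 :: "(nat \<times> nat) \<times> nat \<times> nat \<Rightarrow> int" where
  "freq4 = (\<lambda>(p, q). freq2 p + freq2 q)"

lemma dirichlet_fourth:
  "complex_of_real ((cmod (dirichlet m K u)) ^ 4) = (\<Sum>q\<in>quads K. add_char m (freq4 q * u))"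
proof -
  have "complex_of_real ((cmod (dirichlet m K u)) ^ 4) =
      complex_of_real ((cmod (dirichlet m K u))\<^sup>2) * complex_of_real ((cmod (dirichlet m K u))\<^sup>2)"
    by (simp flip: of_real_mult power_add)
  also have "\<dots> = (\<Sum>p\<in>{..<K} \<times> {..<K}. \<Sum>q\<in>{..<K} \<times> {..<K}. add_char m (freq2 p * u) * add_char m (freq2 q * u))"
    unfolding dirichlet_square sum_product by (simp add: freq2_def split_def)
  also have "\<dots> = (\<Sum>q\<in>quads K. add_char m (freq4 q * u))"
    unfolding quads_def sum.cartesian_product
    by (intro sum.cong) (auto simp: freq4_def add_char_add ring_distribs)
  finally show ?thesis .
qed

text \<open>Three of the four indices and the frequency determine the fourth.\<close>

lemma card_quads_fibre_le: "card {q \<in> quads K. freq4 q = h} \<le> K ^ 3"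
proof -
  have "card {q \<in> quads K. freq4 q = h} \<le> card ({..<K} \<times> {..<K} \<times> {..<K})"
  proof (rule card_inj_on_le)
    show "inj_on (\<lambda>((i, j), (k, l)). (i, j, k)) {q \<in> quads K. freq4 q = h}"
      by (auto simp: inj_on_def freq4_def freq2_def)
    show "(\<lambda>((i, j), (k, l)). (i, j, k)) ` {q \<in> quads K. freq4 q = h} \<subseteq> {..<K} \<times> {..<K} \<times> {..<K}"
      by (auto simp: quads_def)
  qed auto
  then show ?thesis by (simp add: card_cartesian_product power3_eq_cube)
qed

lemma card_pairs_fibre_le: "card {p \<in> {..<K} \<times> {..<K}. freq2 p = h} \<le> K"
proof -
  have "card {p \<in> {..<K} \<times> {..<K}. freq2 p = h} \<le> card {..<K}"
  proof (rule card_inj_on_le)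
    show "inj_on fst {p \<in> {..<K} \<times> {..<K}. freq2 p = h}"
      by (auto simp: inj_on_def freq2_def)
  qed auto
  then show ?thesis by simp
qed

text \<open>This is the additive energy of an interval. Frequency 0 means i + k = j + l, so the
  count is the sum of r(s)^2, where r(s) counts the pairs with sum s. The r(s) total K^2 over fewer
  than 2 K + 1 values of s, and Cauchy-Schwarz gives K^4 <= 2 K times the count.\<close>

lemma card_quads_zero_ge: "real K ^ 3 \<le> 2 * real (card {q \<in> quads K. freq4 q = 0})"
proof -
  define r where "r s = card {(i, k). i < K \<and> k < K \<and> i + k = s}" for s
  have fin: "finite {(i, k). i < K \<and> k < K \<and> i + k = s}" for s
    by (rule finite_subset[of _ "{..<K} \<times> {..<K}"]) auto
  have "(\<Sum>s<2 * K. r s) = card (\<Union>s<2 * K. {(i, k). i < K \<and> k < K \<and> i + k = s})"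
    unfolding r_def by (subst card_UN_disjoint) (use fin in auto)
  also have "(\<Union>s<2 * K. {(i, k). i < K \<and> k < K \<and> i + k = s}) = {..<K} \<times> {..<K}" by auto
  finally have tot: "(\<Sum>s<2 * K. r s) = K * K" by (simp add: card_cartesian_product)
  have sq: "(\<Sum>s<2 * K. r s * r s) = card {q \<in> quads K. freq4 q = 0}"
  proof -
    let ?A = "\<lambda>s. {(i, k). i < K \<and> k < K \<and> i + k = s} \<times> {(i, k). i < K \<and> k < K \<and> i + k = s}"
    have "(\<Sum>s<2 * K. r s * r s) = (\<Sum>s<2 * K. card (?A s))"
      by (simp add: r_def card_cartesian_product)
    also have "\<dots> = card (\<Union>s<2 * K. ?A s)"
      by (subst card_UN_disjoint) (use fin in auto)
    also have "\<dots> = card {q \<in> quads K. freq4 q = 0}"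
    proof (rule bij_betw_same_card)
      show "bij_betw (\<lambda>((i, k), (j, l)). ((i, j), (k, l))) (\<Union>s<2 * K. ?A s) {q \<in> quads K. freq4 q = 0}"
        by (rule bij_betw_byWitness[where f' = "\<lambda>((i, j), (k, l)). ((i, k), (j, l))"])
           (auto simp: quads_def freq4_def freq2_def)
    qed
    finally show ?thesis .
  qed
  have "real (K * K) ^ 2 = (\<Sum>s<2 * K. 1 * real (r s)) ^ 2" by (simp flip: tot)
  also have "\<dots> \<le> (\<Sum>s<2 * K. 1\<^sup>2) * (\<Sum>s<2 * K. (real (r s))\<^sup>2)"
    by (rule Cauchy_Schwarz_ineq_sum)
  also have "(\<Sum>s<2 * K. (real (r s))\<^sup>2) = real (\<Sum>s<2 * K. r s * r s)"
    by (simp add: power2_eq_square)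
  finally have "real K * real K ^ 3 \<le> real K * (2 * real (card {q \<in> quads K. freq4 q = 0}))"
    unfolding sq by (simp add: power2_eq_square power3_eq_cube algebra_simps)
  then show ?thesis by (cases "K = 0") auto
qed

section \<open>Fourier coefficients of a set of residues\<close>

definition fourier :: "nat \<Rightarrow> int set \<Rightarrow> int \<Rightarrow> complex" where
  "fourier m B t = (\<Sum>a\<in>B. add_char m (t * a))"

lemma fourier_mod: "m > 0 \<Longrightarrow> fourier m B (t mod int m) = fourier m B t"
  unfolding fourier_def
  by (intro sum.cong refl add_char_cong) (simp_all add: Cong.cong_def mod_mult_left_eq)

text \<open>Each frequency contributes a character sum over \<open>B\<close>; the shift
  \<open>c\<close> only multiplies it by a phase of modulus 1. Frequency 0 gives the main term, and
  grouping the rest by frequency costs the multiplicity \<open>M\<close>. It is applied to pairs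
  (second moment, \<open>M = K\<close>) and to quadruples (fourth moment,
  \<open>M = K ^ 3\<close>).\<close>

lemma sum_fourier_freq:
  fixes f :: "'a \<Rightarrow> int" and K M :: nat
  assumes fin: "finite Q" and le: "\<And>h. card {q \<in> Q. f q = h} \<le> M"
    and range: "\<And>q. q \<in> Q \<Longrightarrow> \<bar>f q\<bar> < 2 * int K"
  defines "H \<equiv> {h. 0 < \<bar>h\<bar> \<and> \<bar>h\<bar> < 2 * int K}"
  shows "cmod ((\<Sum>q\<in>Q. \<Sum>a\<in>B. add_char m (f q * (u * a - c))) - card {q \<in> Q. f q = 0} * card B)
    \<le> M * (\<Sum>h\<in>H. cmod (fourier m B (h * u)))"
proof -
  define T where "T h = (\<Sum>a\<in>B. add_char m (h * (u * a - c)))" for h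
  have T0: "T 0 = card B" by (simp add: T_def)
  have nT: "cmod (T h) = cmod (fourier m B (h * u))" for h
  proof -
    have "T h = add_char m (- h * c) * fourier m B (h * u)"
      unfolding T_def fourier_def sum_distrib_left
      by (intro sum.cong refl) (simp flip: add_char_add add: algebra_simps)
    then show ?thesis by (simp add: norm_mult)
  qed
  have finH: "finite H" unfolding H_def
    by (rule finite_subset[of _ "{- 2 * int K..2 * int K}"]) auto
  have "(\<Sum>q\<in>Q. T (f q)) = (\<Sum>q\<in>{q \<in> Q. f q = 0}. T (f q)) + (\<Sum>q\<in>{q \<in> Q. f q \<noteq> 0}. T (f q))"
    using fin by (subst sum.union_disjoint[symmetric]) (auto intro!: sum.cong)
  also have "(\<Sum>q\<in>{q \<in> Q. f q = 0}. T (f q)) = card {q \<in> Q. f q = 0} * card B"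
    by (simp add: T0)
  finally have "(\<Sum>q\<in>Q. T (f q)) - card {q \<in> Q. f q = 0} * card B = (\<Sum>q\<in>{q \<in> Q. f q \<noteq> 0}. T (f q))"
    by simp
  moreover have "cmod (\<Sum>q\<in>{q \<in> Q. f q \<noteq> 0}. T (f q)) \<le> M * (\<Sum>h\<in>H. cmod (T h))"
  proof -
    have "cmod (\<Sum>q\<in>{q \<in> Q. f q \<noteq> 0}. T (f q)) \<le> (\<Sum>q\<in>{q \<in> Q. f q \<noteq> 0}. cmod (T (f q)))"
      by (rule norm_sum)
    also have "\<dots> = (\<Sum>h\<in>H. \<Sum>q\<in>{q \<in> {q \<in> Q. f q \<noteq> 0}. f q = h}. cmod (T (f q)))"
      using fin finH range by (intro sum.group[symmetric]) (auto simp: H_def)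
    also have "\<dots> = (\<Sum>h\<in>H. card {q \<in> {q \<in> Q. f q \<noteq> 0}. f q = h} * cmod (T h))"
      by (intro sum.cong) auto
    also have "\<dots> \<le> (\<Sum>h\<in>H. M * cmod (T h))"
    proof (intro sum_mono mult_right_mono)
      fix h
      have "card {q \<in> {q \<in> Q. f q \<noteq> 0}. f q = h} \<le> card {q \<in> Q. f q = h}"
        using fin by (intro card_mono) auto
      then show "real (card {q \<in> {q \<in> Q. f q \<noteq> 0}. f q = h}) \<le> real M"
        using le[of h] by linarith
    qed auto
    finally show ?thesis by (simp add: sum_distrib_left)
  qed
  ultimately show ?thesis unfolding nT by (simp add: T_def)
qed

text \<open>On \<open>B\<close> one has |F|^4 <= \<tau> |F|^2. With S the sum of Fourier
  coefficients, the left side totals at least K^3 (|B| / 2 - S), the right side at most \<tau> K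
  (|B| + S) <= K^3 (|B| + S) / 4. Comparing the two yields |B| <= 5 S.\<close>

lemma card_le_sum_fourier:
  fixes \<tau> :: real
  assumes "K > 0" and tau: "4 * \<tau> \<le> real K ^ 2" and tau0: "0 \<le> \<tau>"
    and small: "\<And>a. a \<in> B \<Longrightarrow> (cmod (dirichlet m K (u * a - c)))\<^sup>2 \<le> \<tau>"
  shows "card B \<le> 5 * (\<Sum>h | 0 < \<bar>h\<bar> \<and> \<bar>h\<bar> < 2 * int K. cmod (fourier m B (h * u)))"
proof -
  let ?S = "\<Sum>h | 0 < \<bar>h\<bar> \<and> \<bar>h\<bar> < 2 * int K. cmod (fourier m B (h * u))"
  let ?F = "\<lambda>a. cmod (dirichlet m K (u * a - c))"
  define E where "E = card {q \<in> quads K. freq4 q = 0}"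
  have S0: "?S \<ge> 0" by (intro sum_nonneg) auto
  have four: "complex_of_real (\<Sum>a\<in>B. ?F a ^ 4) = (\<Sum>q\<in>quads K. \<Sum>a\<in>B. add_char m (freq4 q * (u * a - c)))"
    unfolding of_real_sum dirichlet_fourth by (rule sum.swap)
  have two: "complex_of_real (\<Sum>a\<in>B. (?F a)\<^sup>2) =
      (\<Sum>q\<in>{..<K} \<times> {..<K}. \<Sum>a\<in>B. add_char m (freq2 q * (u * a - c)))"
    unfolding of_real_sum dirichlet_square by (subst sum.swap) (simp add: freq2_def split_def)
  have "cmod (complex_of_real (\<Sum>a\<in>B. ?F a ^ 4) - E * card B) \<le> real (K ^ 3) * ?S"
    unfolding four E_def
    by (rule sum_fourier_freq)
       (use card_quads_fibre_le in \<open>auto simp: quads_def freq4_def freq2_def\<close>)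
  then have "cmod (complex_of_real ((\<Sum>a\<in>B. ?F a ^ 4) - E * card B)) \<le> real (K ^ 3) * ?S"
    by simp
  then have lo: "E * card B - K ^ 3 * ?S \<le> (\<Sum>a\<in>B. ?F a ^ 4)"
    unfolding norm_of_real by simp
  have diag: "{q \<in> {..<K} \<times> {..<K}. freq2 q = 0} = (\<lambda>i. (i, i)) ` {..<K}"
    by (auto simp: freq2_def)
  have cd: "card {q \<in> {..<K} \<times> {..<K}. freq2 q = 0} = K"
    unfolding diag by (subst card_image) (auto simp: inj_on_def)
  have "cmod (complex_of_real (\<Sum>a\<in>B. (?F a)\<^sup>2) - card {q \<in> {..<K} \<times> {..<K}. freq2 q = 0} * card B) \<le> real K * ?S"
    unfolding two
    by (rule sum_fourier_freq)
       (use card_pairs_fibre_le in \<open>auto simp: freq2_def\<close>)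
  then have "cmod (complex_of_real ((\<Sum>a\<in>B. (?F a)\<^sup>2) - K * card B)) \<le> real K * ?S"
    unfolding cd by simp
  then have hi: "(\<Sum>a\<in>B. (?F a)\<^sup>2) \<le> K * card B + K * ?S"
    unfolding norm_of_real by simp
  have "(\<Sum>a\<in>B. ?F a ^ 4) \<le> (\<Sum>a\<in>B. \<tau> * (?F a)\<^sup>2)"
  proof (rule sum_mono)
    fix a assume "a \<in> B"
    then have "(?F a)\<^sup>2 * (?F a)\<^sup>2 \<le> \<tau> * (?F a)\<^sup>2"
      using small by (intro mult_right_mono) auto
    then show "?F a ^ 4 \<le> \<tau> * (?F a)\<^sup>2" by (simp flip: power_add)
  qed
  also have "\<dots> \<le> \<tau> * (K * card B + K * ?S)"
    unfolding sum_distrib_left[symmetric] using hi tau0 by (intro mult_left_mono)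
  also have "\<dots> = 4 * \<tau> * (K / 4 * (card B + ?S))" by (simp add: algebra_simps)
  also have "\<dots> \<le> real K ^ 2 * (K / 4 * (card B + ?S))"
    using tau S0 by (intro mult_right_mono) auto
  finally have "E * card B - K ^ 3 * ?S \<le> K ^ 3 / 4 * (card B + ?S)"
    using lo by (simp add: power2_eq_square power3_eq_cube)
  \<comment> \<open>The energy bound makes the main term of the fourth moment at least K^3 |B| / 2,
    twice what the second moment can absorb.\<close>
  moreover have "real K ^ 3 * real (card B) \<le> 2 * (real E * real (card B))"
    using mult_right_mono[OF card_quads_zero_ge[of K] of_nat_0_le_iff, of "card B"]
    by (simp only: E_def of_nat_mult of_nat_power mult.assoc)
  ultimately have "real K ^ 3 * real (card B) \<le> real K ^ 3 * (5 * ?S)" by (simp add: algebra_simps)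
  then show ?thesis using assms(1) by simp
qed

section \<open>The large sieve bound\<close>

lemma sum_add_char_complete:
  assumes "m > 0"
  shows "(\<Sum>l\<in>{0..<int m}. add_char m (l * a)) = (if int m dvd a then of_nat m else 0)"
proof -
  have "(\<Sum>l\<in>{0..<int m}. add_char m (l * a)) = dirichlet m m a"
    unfolding dirichlet_def
    by (rule sum.reindex_bij_witness[of _ int nat]) auto
  also have "\<dots> = (if int m dvd a then of_nat m else 0)"
  proof (cases "int m dvd a")
    case True
    then show ?thesis using assms by (simp add: dirichlet_def add_char_dvd)
  next
    case False
    then have "a mod int m \<noteq> 0" by (simp add: dvd_eq_mod_eq_0)
    moreover have "0 \<le> a mod int m" "a mod int m < int m" using assms by simp_all
    ultimately have "1 \<le> a mod int m" "a mod int m \<le> int m - 1" by linarith+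
    moreover from this have "real_of_int (a mod int m) \<le> real_of_int (int m - 1)"
      by (simp only: of_int_le_iff)
    \<comment> \<open>The gap with d = 1 serves only to show that the ratio of the geometric series
      differs from 1.\<close>
    ultimately have "2 * 1 / m \<le> cmod (add_char m a - 1)" using assms by (intro add_char_gap) auto
    then have ne: "add_char m a \<noteq> 1" using assms by (auto simp: field_simps)
    have "dirichlet m m a = (add_char m a ^ m - 1) / (add_char m a - 1)"
      unfolding dirichlet_def add_char_mult_nat using ne by (rule geometric_sum)
    also have "add_char m a ^ m = 1" using assms by (simp add: add_char_dvd flip: add_char_mult_nat)
    finally show ?thesis using False by simp
  qed
  finally show ?thesis .
qed

text \<open>Expanding the square and summing over all frequencies leaves the pairs congruent modulo
  \<open>m\<close>; these are diagonal, since \<open>B\<close> consists of least nonnegative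
  representatives.\<close>

lemma parseval:
  assumes "m > 0" "B \<subseteq> {0..<int m}"
  shows "(\<Sum>l\<in>{0..<int m}. (cmod (fourier m B l))\<^sup>2) = m * card B"
proof -
  have fin: "finite B" using assms finite_subset by blast
  have "complex_of_real (\<Sum>l\<in>{0..<int m}. (cmod (fourier m B l))\<^sup>2) =
      (\<Sum>l\<in>{0..<int m}. \<Sum>a\<in>B. \<Sum>b\<in>B. add_char m (l * (a - b)))"
    unfolding of_real_sum complex_norm_square fourier_def cnj_sum sum_product cnj_add_char
    by (simp flip: add_char_add add: algebra_simps)
  also have "\<dots> = (\<Sum>a\<in>B. \<Sum>b\<in>B. \<Sum>l\<in>{0..<int m}. add_char m (l * (a - b)))"
    by (subst sum.swap) (intro sum.cong refl sum.swap)
  also have "\<dots> = (\<Sum>a\<in>B. \<Sum>b\<in>B. if b = a then of_nat m else 0)"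
  proof (intro sum.cong refl)
    fix a b assume "a \<in> B" "b \<in> B"
    then have "0 \<le> a" "a < int m" "0 \<le> b" "b < int m" using assms(2) by auto
    then have "int m dvd a - b \<longleftrightarrow> b = a"
      by (metis mod_eq_dvd_iff mod_pos_pos_trivial)
    then show "(\<Sum>l\<in>{0..<int m}. add_char m (l * (a - b))) = (if b = a then of_nat m else 0)"
      by (simp add: sum_add_char_complete[OF assms(1)])
  qed
  also have "\<dots> = of_real (m * card B)" using fin by (simp add: sum.delta)
  finally show ?thesis unfolding of_real_eq_iff .
qed

text \<open>Sum \<open>le\<close> over \<open>X\<close>, apply Cauchy-Schwarz over the pairs (h, x),
  and collect the pairs by the residue of \<open>h * f x\<close>. Each residue occurs at most \<nu>
  times, so Parseval bounds the second factor. The 25 is the square of the 5 in \<open>le\<close>.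
  In the application \<open>f x\<close> is the inverse of \<open>x\<close> modulo
  \<open>m\<close>.\<close>

lemma large_sieve:
  fixes f :: "'a \<Rightarrow> int" and \<nu> :: real
  assumes m: "m > 0" and B: "B \<subseteq> {0..<int m}" and fin: "finite H" "finite X"
    and nu: "\<And>l. card {(h, x) \<in> H \<times> X. h * f x mod int m = l} \<le> \<nu>"
    and le: "\<And>x. x \<in> X \<Longrightarrow> card B \<le> 5 * (\<Sum>h\<in>H. cmod (fourier m B (h * f x)))"
  shows "card X * card B \<le> 25 * card H * \<nu> * m"
proof -
  define G where "G = (\<lambda>(h, x). cmod (fourier m B (h * f x)))"
  have finHX: "finite (H \<times> X)" using fin by simp
  have "card X * card B = (\<Sum>x\<in>X. real (card B))" by simp
  also have "\<dots> \<le> (\<Sum>x\<in>X. 5 * (\<Sum>h\<in>H. cmod (fourier m B (h * f x))))"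
    by (intro sum_mono le)
  also have "\<dots> = 5 * (\<Sum>q\<in>H \<times> X. 1 * G q)"
    unfolding sum_distrib_left[symmetric] G_def
    by (subst sum.swap) (simp add: sum.cartesian_product)
  finally have "(real (card X * card B))\<^sup>2 \<le> (5 * (\<Sum>q\<in>H \<times> X. 1 * G q))\<^sup>2"
    by (rule power_mono) simp
  also have "\<dots> = 25 * (\<Sum>q\<in>H \<times> X. 1 * G q)\<^sup>2" by (simp add: power_mult_distrib)
  also have "\<dots> \<le> 25 * ((\<Sum>q\<in>H \<times> X. 1\<^sup>2) * (\<Sum>q\<in>H \<times> X. (G q)\<^sup>2))"
    by (intro mult_left_mono Cauchy_Schwarz_ineq_sum) simp
  also have "(\<Sum>q\<in>H \<times> X. 1\<^sup>2) = real (card H * card X)" by (simp add: card_cartesian_product)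
  finally have *: "(real (card X * card B))\<^sup>2 \<le> 25 * (real (card H * card X) * (\<Sum>q\<in>H \<times> X. (G q)\<^sup>2))" .
  have "(\<Sum>q\<in>H \<times> X. (G q)\<^sup>2) \<le> \<nu> * (m * card B)"
  proof -
    have "(\<Sum>q\<in>H \<times> X. (G q)\<^sup>2) =
        (\<Sum>l\<in>{0..<int m}. \<Sum>q\<in>{q \<in> H \<times> X. (case q of (h, x) \<Rightarrow> h * f x mod int m) = l}. (G q)\<^sup>2)"
      using finHX m by (intro sum.group[symmetric]) auto
    also have "\<dots> = (\<Sum>l\<in>{0..<int m}. \<Sum>q\<in>{(h, x) \<in> H \<times> X. h * f x mod int m = l}. (cmod (fourier m B l))\<^sup>2)"
      by (intro sum.cong) (auto simp: G_def fourier_mod[OF m])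
    also have "\<dots> = (\<Sum>l\<in>{0..<int m}. card {(h, x) \<in> H \<times> X. h * f x mod int m = l} * (cmod (fourier m B l))\<^sup>2)"
      by simp
    also have "\<dots> \<le> (\<Sum>l\<in>{0..<int m}. \<nu> * (cmod (fourier m B l))\<^sup>2)"
      by (intro sum_mono mult_right_mono nu) simp
    also have "\<dots> = \<nu> * (m * card B)"
      unfolding sum_distrib_left[symmetric] parseval[OF m B] by simp
    finally show ?thesis .
  qed
  then have "25 * (real (card H * card X) * (\<Sum>q\<in>H \<times> X. (G q)\<^sup>2))
      \<le> 25 * (real (card H * card X) * (\<nu> * (m * card B)))"
    by (intro mult_left_mono) auto
  with * have "real (card X * card B) * real (card X * card B)
      \<le> real (card X * card B) * (25 * card H * \<nu> * m)"
    by (simp add: power2_eq_square mult_ac)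
  \<comment> \<open>Needed when the common factor |X| |B| vanishes and cannot be cancelled.\<close>
  moreover have "\<nu> \<ge> 0" using nu[of 0] of_nat_0_le_iff order_trans by blast
  ultimately show ?thesis
    by (cases "card X * card B = 0") (auto simp: mult_le_cancel_left)
qed

text \<open>Two pairs \<open>(h, x)\<close>, \<open>(h', x')\<close> in one class satisfy \<open>h * x' \<equiv> h' * x\<close> but not
  \<open>h * x' = h' * x\<close>, so the slopes \<open>h / x\<close> are spaced by at least \<open>m / N\<^sup>2\<close>.\<close>
lemma card_slopes_le:
  fixes N :: real and K :: nat and f :: "int \<Rightarrow> int"
  assumes m: "m > 0" and N: "N > 0" and fin: "finite X"
    and X: "\<And>x. x \<in> X \<Longrightarrow> prime x \<and> N / 4 \<le> x \<and> x \<le> N \<and> [x * f x = 1] (mod int m)"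
    and KN: "2 * K \<le> N / 4" and Km: "4 * K \<le> m"
  shows "card {(h, x) \<in> {h. 0 < \<bar>h\<bar> \<and> \<bar>h\<bar> < 2 * int K} \<times> X. h * f x mod int m = l}
    \<le> 16 * K * N / m + 2"
proof -
  let ?A = "{(h, x) \<in> {h. 0 < \<bar>h\<bar> \<and> \<bar>h\<bar> < 2 * int K} \<times> X. h * f x mod int m = l}"
  \<comment> \<open>The factor \<open>N\<^sup>2 / m\<close> rescales the slopes so that the spacing
    becomes 1.\<close>
  define s where "s = (\<lambda>(h::int, x::int). real_of_int h / real_of_int x * (N\<^sup>2 / m))"
  have sep: "\<bar>s (h, x) - s (h', x')\<bar> \<ge> 1"
    if A: "(h, x) \<in> ?A" "(h', x') \<in> ?A" and ne: "(h, x) \<noteq> (h', x')" for h x h' x'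
  proof -
    have x: "prime x" "prime x'" "N / 4 \<le> x" "N / 4 \<le> x'" "x \<le> N" "x' \<le> N"
      "[x * f x = 1] (mod int m)" "[x' * f x' = 1] (mod int m)" using X A by auto
    have h: "0 < \<bar>h\<bar>" "\<bar>h\<bar> < 2 * int K" "0 < \<bar>h'\<bar>" "\<bar>h'\<bar> < 2 * int K" using A by auto
    have pos: "0 < x" "0 < x'" using x prime_gt_0_int by blast+
    have "[h * f x = h' * f x'] (mod int m)" using A by (auto simp: Cong.cong_def)
    \<comment> \<open>Multiplying by x x' clears the inverses \<open>f x\<close> and
      \<open>f x'\<close>.\<close>
    then have "[(h * f x) * (x * x') = (h' * f x') * (x * x')] (mod int m)"
      by (rule cong_mult) simp
    moreover have "[(h * x') * (x * f x) = (h * x') * 1] (mod int m)"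
      by (rule cong_mult) (use x in simp_all)
    moreover have "[(h' * x) * (x' * f x') = (h' * x) * 1] (mod int m)"
      by (rule cong_mult) (use x in simp_all)
    ultimately have c: "[h * x' = h' * x] (mod int m)"
      by (simp add: mult_ac) (metis cong_sym cong_trans)
    have neq: "h * x' \<noteq> h' * x"
    proof
      assume eq: "h * x' = h' * x"
      show False
      proof (cases "x = x'")
        case True
        then show False using eq pos ne by simp
      next
        case False
        \<comment> \<open>Equality would make the prime \<open>x\<close>, distinct from the prime
          \<open>x'\<close>, divide \<open>h\<close>, although 0 < |h| < 2 K <= N / 4 <= x.\<close>
        have "x dvd h * x'" using eq by simp
        then have "x dvd h" using x False
          by (metis prime_dvd_mult_iff primes_dvd_imp_eq)
        then have "\<bar>x\<bar> \<le> \<bar>h\<bar>" using h by (intro dvd_imp_le_int) auto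
        then have "x < 2 * int K" using h pos by linarith
        then show False using x(3) KN by linarith
      qed
    qed
    have "int m dvd h * x' - h' * x" using c by (simp add: cong_iff_dvd_diff)
    then have "int m \<le> \<bar>h * x' - h' * x\<bar>" using neq dvd_imp_le_int[of "h * x' - h' * x" "int m"] by simp
    then have d: "real m \<le> \<bar>real_of_int (h * x' - h' * x)\<bar>" by linarith
    have "s (h, x) - s (h', x') = real_of_int (h * x' - h' * x) / (real_of_int x * real_of_int x') * (N\<^sup>2 / m)"
      using pos m by (simp add: s_def field_simps)
    then have eq: "\<bar>s (h, x) - s (h', x')\<bar> =
        (\<bar>real_of_int (h * x' - h' * x)\<bar> / m) * (N\<^sup>2 / (real_of_int x * real_of_int x'))"
      using pos m by (simp add: abs_mult)
    have "real_of_int x * real_of_int x' \<le> N\<^sup>2"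
      unfolding power2_eq_square using x pos N by (intro mult_mono) auto
    then have "1 \<le> N\<^sup>2 / (real_of_int x * real_of_int x')" using pos by simp
    moreover have "1 \<le> \<bar>real_of_int (h * x' - h' * x)\<bar> / m" using d m by simp
    ultimately show ?thesis unfolding eq using mult_mono[of 1 _ 1] by force
  qed
  define R where "R = 8 * K * N / m"
  have R0: "R \<ge> 0" using N by (simp add: R_def)
  have bound: "\<bar>s q\<bar> \<le> R" if "q \<in> ?A" for q
  proof -
    obtain h x where q: "q = (h, x)" by force
    have x: "N / 4 \<le> x" and h: "\<bar>h\<bar> < 2 * int K" using that X unfolding q by auto
    have "\<bar>real_of_int h\<bar> / real_of_int x \<le> (2 * K) / (N / 4)"
      using x h N by (intro frac_le) auto
    then have "\<bar>real_of_int h\<bar> / real_of_int x * (N\<^sup>2 / m) \<le> (2 * K) / (N / 4) * (N\<^sup>2 / m)"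
      by (intro mult_right_mono) auto
    moreover have "\<bar>s q\<bar> = \<bar>real_of_int h\<bar> / real_of_int x * (N\<^sup>2 / m)"
      using x N by (simp add: q s_def abs_mult)
    moreover have "(2 * K) / (N / 4) * (N\<^sup>2 / m) = R"
      using N by (simp add: R_def power2_eq_square)
    ultimately show ?thesis by simp
  qed
  \<comment> \<open>Points at mutual distance at least 1 have distinct floors, so counting reduces
    to the integers in this range, at most 2 R + 2 of them.\<close>
  have "card ?A \<le> card {\<lfloor>- R\<rfloor>..\<lfloor>R\<rfloor>}"
  proof (rule card_inj_on_le)
    show "inj_on (\<lambda>q. \<lfloor>s q\<rfloor>) ?A"
    proof (rule inj_onI, rule ccontr)
      fix p q assume pq: "p \<in> ?A" "q \<in> ?A" "\<lfloor>s p\<rfloor> = \<lfloor>s q\<rfloor>" "p \<noteq> q"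
      then have "\<bar>s p - s q\<bar> \<ge> 1" using sep by (cases p; cases q) blast
      then show False using pq(3) by linarith
    qed
    show "(\<lambda>q. \<lfloor>s q\<rfloor>) ` ?A \<subseteq> {\<lfloor>- R\<rfloor>..\<lfloor>R\<rfloor>}"
    proof
      fix v assume "v \<in> (\<lambda>q. \<lfloor>s q\<rfloor>) ` ?A"
      then obtain q where "q \<in> ?A" "v = \<lfloor>s q\<rfloor>" by blast
      then show "v \<in> {\<lfloor>- R\<rfloor>..\<lfloor>R\<rfloor>}" using bound[of q] by (auto intro!: floor_mono)
    qed
  qed simp
  also have "real (card {\<lfloor>- R\<rfloor>..\<lfloor>R\<rfloor>}) \<le> 2 * R + 2"
    using R0 by simp linarith
  finally show ?thesis unfolding R_def by simp
qed

section \<open>A Chebyshev bound for primes in an interval\<close>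

lemma card_multiples:
  assumes "d > 0"
  shows "card {k \<in> {1..n}. d dvd k} = n div d"
proof -
  have "{k \<in> {1..n}. d dvd k} = (\<lambda>j. d * j) ` {1..n div d}"
  proof (intro equalityI subsetI)
    fix k assume "k \<in> {k \<in> {1..n}. d dvd k}"
    then obtain j where "k = d * j" "1 \<le> d * j" "d * j \<le> n" by auto
    moreover from this have "1 \<le> j" by (cases j) auto
    ultimately show "k \<in> (\<lambda>j. d * j) ` {1..n div d}"
      using assms by (auto simp: less_eq_div_iff_mult_less_eq mult.commute)
  qed (use assms in \<open>auto simp: less_eq_div_iff_mult_less_eq mult.commute Suc_le_eq\<close>)
  also have "card \<dots> = n div d"
    using assms by (subst card_image) (auto simp: inj_on_def)
  finally show ?thesis .
qed

text \<open>Sum the identity ln k = sum of the von Mangoldt function over the divisors of k. The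
  limit \<open>M\<close> may exceed \<open>n\<close> (the extra terms vanish), so that three
  factorials can share one range of summation.\<close>

lemma ln_fact_mangoldt:
  assumes "n \<le> M"
  shows "ln (fact n :: real) = (\<Sum>d\<in>{1..M}. mangoldt d * real (n div d))"
proof -
  have "ln (fact n :: real) = (\<Sum>k\<in>{1..n}. ln (real k))"
    unfolding fact_prod of_nat_prod by (subst ln_prod) auto
  also have "\<dots> = (\<Sum>k\<in>{1..n}. \<Sum>d\<in>{1..M}. if d dvd k then mangoldt d else 0)"
  proof (intro sum.cong refl)
    fix k assume k: "k \<in> {1..n}"
    then have "{d \<in> {1..M}. d dvd k} = {d. d dvd k}"
      using assms by (auto dest: dvd_imp_le intro!: Nat.gr0I simp: Suc_le_eq)
    then have "(\<Sum>d\<in>{1..M}. if d dvd k then mangoldt d else 0) = (\<Sum>d | d dvd k. mangoldt d :: real)"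
      by (simp flip: sum.inter_filter)
    then show "ln (real k) = (\<Sum>d\<in>{1..M}. if d dvd k then mangoldt d else 0)"
      using k mangoldt_sum[of k, where 'a = real] by simp
  qed
  also have "\<dots> = (\<Sum>d\<in>{1..M}. \<Sum>k\<in>{1..n}. if d dvd k then mangoldt d else 0)"
    by (rule sum.swap)
  also have "\<dots> = (\<Sum>d\<in>{1..M}. mangoldt d * real (n div d))"
    using card_multiples by (intro sum.cong refl) (simp add: mult.commute flip: sum.inter_filter)
  finally show ?thesis .
qed

lemma ln_binomial_mangoldt:
  "ln (real ((a + b) choose a)) =
     (\<Sum>d\<in>{1..a + b}. mangoldt d * (real ((a + b) div d) - real (a div d) - real (b div d)))"
proof -
  have "real ((a + b) choose a) = fact (a + b) / (fact a * fact b)"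
    by (simp add: binomial_fact)
  then have "ln (real ((a + b) choose a)) = ln (fact (a + b)) - ln (fact a) - ln (fact b)"
    by (simp add: ln_div ln_mult)
  also have "\<dots> = (\<Sum>d\<in>{1..a + b}. mangoldt d * (real ((a + b) div d) - real (a div d) - real (b div d)))"
    using ln_fact_mangoldt[of "a + b" "a + b"] ln_fact_mangoldt[of a "a + b"] ln_fact_mangoldt[of b "a + b"]
    by (simp add: sum_subtractf sum.distrib algebra_simps)
  finally show ?thesis .
qed

section \<open>Chebyshev's functions\<close>

definition theta :: "nat \<Rightarrow> real" where
  "theta n = (\<Sum>p | prime p \<and> p \<le> n. ln (real p))"

definition psi :: "nat \<Rightarrow> real" where
  "psi n = (\<Sum>d\<in>{1..n}. mangoldt d)"

lemma finite_primes_le [simp]: "finite {p::nat. prime p \<and> p \<le> n}"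
  by (rule finite_subset[of _ "{..n}"]) auto

text \<open>Adding two remainders modulo d carries at most once, so each bracket in
  \<open>ln_binomial_mangoldt\<close> is at most 1.\<close>

lemma ln_binomial_le_psi: "ln (real ((a + b) choose a)) \<le> psi (a + b)"
  unfolding ln_binomial_mangoldt psi_def
proof (rule sum_mono)
  fix d :: nat
  assume "d \<in> {1..a + b}"
  then have "d > 0" by simp
  have "a mod d + b mod d < 2 * d"
    using mod_less_divisor[OF \<open>d > 0\<close>, of a] mod_less_divisor[OF \<open>d > 0\<close>, of b] by linarith
  then have "(a mod d + b mod d) div d < 2" by (rule less_mult_imp_div_less)
  then have "(a + b) div d \<le> a div d + b div d + 1"
    using div_add1_eq[of a b d] by linarith
  then have "real ((a + b) div d) - real (a div d) - real (b div d) \<le> 1" by linarith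
  then show "mangoldt d * (real ((a + b) div d) - real (a div d) - real (b div d)) \<le> mangoldt d"
    using mult_left_mono[OF _ mangoldt_nonneg, of _ 1 d] by simp
qed

text \<open>For a prime p with a <= b < p <= a + b < 2 p the bracket in
  \<open>ln_binomial_mangoldt\<close> equals 1; all other terms are nonnegative.\<close>

lemma theta_diff_le_ln_binomial:
  assumes "a \<le> b"
  shows "(\<Sum>p | prime p \<and> b < p \<and> p \<le> a + b. ln (real p)) \<le> ln (real ((a + b) choose a))"
proof -
  have "(\<Sum>p | prime p \<and> b < p \<and> p \<le> a + b. ln (real p)) =
      (\<Sum>p | prime p \<and> b < p \<and> p \<le> a + b. mangoldt p * (real ((a + b) div p) - real (a div p) - real (b div p)))"
  proof (intro sum.cong refl)
    fix p assume p: "p \<in> {p. prime p \<and> b < p \<and> p \<le> a + b}"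
    then have "a div p = 0" "b div p = 0" using assms by auto
    moreover have "(a + b) div p = 1"
      using p assms by (intro div_nat_eqI) auto
    ultimately show "ln (real p) = mangoldt p * (real ((a + b) div p) - real (a div p) - real (b div p))"
      using p by simp
  qed
  also have "\<dots> \<le> ln (real ((a + b) choose a))"
    unfolding ln_binomial_mangoldt
  proof (rule sum_mono2)
    show "{p. prime p \<and> b < p \<and> p \<le> a + b} \<subseteq> {1..a + b}"
      by (auto simp: Suc_le_eq prime_gt_0_nat)
    fix d
    have "a div d + b div d \<le> (a + b) div d" using div_add1_eq[of a b d] by linarith
    then have "0 \<le> real ((a + b) div d) - real (a div d) - real (b div d)" by linarith
    then show "0 \<le> mangoldt d * (real ((a + b) div d) - real (a div d) - real (b div d))"
      by (simp add: mangoldt_nonneg)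
  qed auto
  finally show ?thesis .
qed

text \<open>Erdos's induction: an even n > 2 is not prime, and for n = 2 k + 1 the primes in (k + 1,
  2 k + 1] are covered by the binomial coefficient of 2 k + 1 over k.\<close>

lemma theta_le: "theta n \<le> n * ln 4"
proof (induction n rule: less_induct)
  case (less n)
  consider "n \<le> 1" | "n = 2" | "n > 2" "even n" | "n > 2" "odd n"
    by (cases "n \<le> 1"; cases "n = 2"; cases "even n") auto
  then show ?case
  proof cases
    case 1
    then have "{p. prime p \<and> p \<le> n} = {}" by (auto dest: prime_ge_2_nat)
    then have "theta n = 0" unfolding theta_def by (simp only: sum.empty)
    then show ?thesis by simp
  next
    case 2
    have "{p. prime p \<and> p \<le> n} = {2::nat}"
      using 2 by (auto dest: prime_ge_2_nat)
    then have "theta n = (\<Sum>p\<in>{2}. ln (real p))" unfolding theta_def by (simp only:)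
    then have "theta n = ln 2" by simp
    also have "\<dots> \<le> 1 * ln 4" by simp
    also have "\<dots> \<le> n * ln 4" using 2 by (intro mult_right_mono) auto
    finally show ?thesis .
  next
    case 3
    have "\<not> prime n" using 3 prime_odd_nat by blast
    then have "{p. prime p \<and> p \<le> n} = {p. prime p \<and> p \<le> n - 1}"
      using 3 by (auto simp: le_less less_Suc_eq_le[symmetric])
    then have "theta n = theta (n - 1)" by (simp add: theta_def)
    also have "\<dots> \<le> real (n - 1) * ln 4" using 3 by (intro less) simp
    also have "\<dots> \<le> real n * ln 4" by (intro mult_right_mono) auto
    finally show ?thesis .
  next
    case 4
    then obtain k where n: "n = 2 * k + 1" by (auto elim: oddE)
    with 4 have k: "k \<ge> 1" by simp
    have "{p. prime p \<and> p \<le> n} = {p. prime p \<and> p \<le> k + 1} \<union> {p. prime p \<and> k + 1 < p \<and> p \<le> k + (k + 1)}"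
      using n by auto
    then have "theta n = theta (k + 1) + (\<Sum>p | prime p \<and> k + 1 < p \<and> p \<le> k + (k + 1). ln (real p))"
      unfolding theta_def by (simp, subst sum.union_disjoint) auto
    also have "theta (k + 1) \<le> (k + 1) * ln 4" using n k by (intro less) simp
    also have "(\<Sum>p | prime p \<and> k + 1 < p \<and> p \<le> k + (k + 1). ln (real p)) \<le> ln (real ((k + (k + 1)) choose k))"
      by (rule theta_diff_le_ln_binomial) simp
    also have "\<dots> \<le> ln (4 ^ k)"
    proof -
      \<comment> \<open>The two middle coefficients are equal and together at most 2^n = 2 *
        4^k.\<close>
      have "(n choose k) + (n choose (k + 1)) = (\<Sum>i\<in>{k, k + 1}. n choose i)" by simp
      also have "\<dots> \<le> (\<Sum>i\<le>n. n choose i)" using n by (intro sum_mono2) auto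
      also have "\<dots> = 2 ^ n" by (rule choose_row_sum)
      finally have "(n choose k) + (n choose (k + 1)) \<le> 2 * 4 ^ k"
        by (simp add: n power_mult)
      moreover have "(n choose k) = (n choose (k + 1))"
        using binomial_symmetric[of k n] n by simp
      ultimately have "(k + (k + 1)) choose k \<le> 4 ^ k" by (simp add: n mult_2)
      then have "real ((k + (k + 1)) choose k) \<le> real (4 ^ k)" by (simp only: of_nat_le_iff)
      moreover have "real ((k + (k + 1)) choose k) > 0" by (simp add: zero_less_binomial)
      ultimately show ?thesis by simp
    qed
    also have "(k + 1) * ln 4 + ln (4 ^ k) = n * ln (4::real)"
      by (simp add: n ln_realpow algebra_simps)
    finally show ?thesis by simp
  qed
qed

text \<open>The difference comes from powers p^k <= n with k >= 2. These have p <= sqrt n and k <=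
  ln n / ln 2, and each contributes at most ln n.\<close>

lemma psi_le_theta:
  assumes "n \<ge> 1"
  shows "psi n \<le> theta n + sqrt n * (ln n / ln 2 + 1) * ln n"
proof -
  let ?A = "{d \<in> {1..n}. prime d}"
  let ?B = "{d \<in> {1..n}. primepow d \<and> \<not> prime d}"
  have "psi n = (\<Sum>d\<in>?A \<union> ?B. mangoldt d)"
    unfolding psi_def by (rule sum.mono_neutral_right) (auto simp: mangoldt_def)
  also have "\<dots> = (\<Sum>d\<in>?A. mangoldt d) + (\<Sum>d\<in>?B. mangoldt d)"
    by (rule sum.union_disjoint) auto
  also have "(\<Sum>d\<in>?A. mangoldt d) = theta n"
    unfolding theta_def by (intro sum.cong) (auto simp: Suc_le_eq prime_gt_0_nat)
  also have "(\<Sum>d\<in>?B. mangoldt d) \<le> (\<Sum>d\<in>?B. ln (real n))"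
  proof (rule sum_mono)
    fix d assume "d \<in> ?B"
    then have "d > 0" "d \<le> n" by auto
    then have "mangoldt d \<le> ln (real d)" "ln (real d) \<le> ln (real n)"
      using mangoldt_le by auto
    then show "mangoldt d \<le> ln (real n)" by (rule order_trans)
  qed
  also have "\<dots> = card ?B * ln n" by simp
  also have "\<dots> \<le> sqrt n * (ln n / ln 2 + 1) * ln n"
  proof (rule mult_right_mono)
    let ?s = "nat \<lfloor>sqrt n\<rfloor>" and ?l = "nat \<lfloor>ln n / ln 2\<rfloor>"
    have "?B \<subseteq> (\<lambda>(p, k). p ^ k) ` ({1..?s} \<times> {0..?l})"
    proof
      fix d assume d: "d \<in> ?B"
      then obtain p k where pk: "prime p" "k > 0" "d = p ^ k" by (auto simp: primepow_def)
      with d have "k \<noteq> 1" by auto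
      with pk have "k \<ge> 2" by simp
      have p2: "p \<ge> 2" using pk prime_ge_2_nat by blast
      then have "p ^ 2 \<le> p ^ k" using \<open>k \<ge> 2\<close> by (intro power_increasing) auto
      then have "p ^ 2 \<le> n" using d pk by simp
      then have "real p \<le> sqrt n" by (intro real_le_rsqrt) (simp flip: of_nat_power)
      then have "p \<le> ?s" by (simp add: le_nat_floor)
      have "2 ^ k \<le> p ^ k" using p2 by (intro power_mono) auto
      then have "2 ^ k \<le> n" by (rule order_trans) (use d pk in auto)
      then have "real (2 ^ k) \<le> real n" by (simp only: of_nat_le_iff)
      then have "ln (2 ^ k) \<le> ln (real n)" using assms by (subst ln_le_cancel_iff) auto
      then have "real k \<le> ln n / ln 2" by (simp add: ln_realpow field_simps)
      then have "k \<le> ?l" by (simp add: le_nat_floor)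
      with \<open>p \<le> ?s\<close> p2 show "d \<in> (\<lambda>(p, k). p ^ k) ` ({1..?s} \<times> {0..?l})"
        by (intro image_eqI[of _ _ "(p, k)"]) (auto simp: pk)
    qed
    then have "card ?B \<le> card ({1..?s} \<times> {0..?l})" by (rule surj_card_le[rotated]) simp
    also have "\<dots> = ?s * (?l + 1)" by (simp add: card_cartesian_product)
    finally have "real (card ?B) \<le> real ?s * (real ?l + 1)"
      by (metis of_nat_1 of_nat_add of_nat_le_iff of_nat_mult)
    also have "\<dots> \<le> sqrt n * (ln n / ln 2 + 1)"
      using assms by (intro mult_mono add_mono) auto
    finally show "real (card ?B) \<le> sqrt n * (ln n / ln 2 + 1)" .
  qed (use assms in simp)
  finally show ?thesis by simp
qed

text \<open>With n about N / 2, the central binomial coefficient bounds psi(2 n) below by about n ln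
  4, and \<open>theta_le\<close> removes the primes up to about n / 2. What remains is about (N / 4)
  ln 4, at most ln N for each prime counted.\<close>

lemma eventually_card_primes_ge:
  "\<forall>\<^sub>F N::real in at_top. N / (4 * ln N) \<le> real (card {p::nat. prime p \<and> N / 4 \<le> p \<and> p \<le> N})"
proof -
  have "\<forall>\<^sub>F N::real in at_top. N \<ge> 4" by (rule eventually_ge_at_top)
  moreover have "\<forall>\<^sub>F N::real in at_top.
      N / 4 \<le> (N / 4 - 1) * ln 4 - ln N - sqrt N * (ln N / ln 2 + 1) * ln N"
  proof -
    \<comment> \<open>Replacing ln 4 by 4/3 leaves the explicit main term N / 3, which beats N /
      4.\<close>
    have ln2: "ln (2::real) \<ge> 2 / 3" by (rule ln2_ge_two_thirds)
    have ln4: "ln (4::real) \<ge> 4 / 3" using ln2 ln_realpow[of 2 2] by simp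
    have "\<forall>\<^sub>F N::real in at_top.
        N / 4 \<le> (N / 4 - 1) * (4 / 3) - ln N - sqrt N * (ln N / (2 / 3) + 1) * ln N"
      by real_asymp
    moreover have "\<forall>\<^sub>F N::real in at_top. N \<ge> 4" by (rule eventually_ge_at_top)
    ultimately show ?thesis
    proof eventually_elim
      case (elim N)
      have "(N / 4 - 1) * (4 / 3) \<le> (N / 4 - 1) * ln 4"
        using elim ln4 by (intro mult_left_mono) auto
      moreover have "sqrt N * (ln N / ln 2 + 1) * ln N \<le> sqrt N * (ln N / (2 / 3) + 1) * ln N"
        using elim ln2 by (intro mult_right_mono mult_left_mono add_mono divide_left_mono) auto
      ultimately show ?case using elim by linarith
    qed
  qed
  ultimately show ?thesis
  proof eventually_elim
    case (elim N)
    define n where "n = nat \<lfloor>N / 2\<rfloor>"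
    let ?P = "{p::nat. prime p \<and> N / 4 \<le> p \<and> p \<le> N}"
    have n: "real n \<le> N / 2" "N / 2 < real n + 1" "n \<ge> 1"
      using elim(1) unfolding n_def by linarith+
    have finP: "finite ?P"
      by (rule finite_subset[of _ "{..nat \<lfloor>N\<rfloor>}"]) (auto simp: le_nat_floor)
    have "n * ln 4 - ln N \<le> n * ln 4 - ln (2 * real n)"
      using n elim(1) by simp
    also have "\<dots> = ln (4 ^ n / (2 * real n))"
      using n by (simp add: ln_div ln_realpow)
    also have "\<dots> \<le> ln (real ((2 * n) choose n))"
      using n central_binomial_lower_bound[of n] by (subst ln_le_cancel_iff) (auto simp: zero_less_binomial)
    also have "\<dots> \<le> psi (2 * n)"
      using ln_binomial_le_psi[of n n] by (simp add: mult_2)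
    also have "\<dots> \<le> theta (2 * n) + sqrt (2 * n) * (ln (2 * n) / ln 2 + 1) * ln (2 * n)"
      using n by (intro psi_le_theta) auto
    also have "sqrt (2 * n) * (ln (2 * n) / ln 2 + 1) * ln (2 * n) \<le> sqrt N * (ln N / ln 2 + 1) * ln N"
      using n elim(1)
      by (intro mult_mono add_mono divide_right_mono) (auto intro!: add_nonneg_nonneg mult_nonneg_nonneg)
    also have "theta (2 * n) \<le> theta ((n + 1) div 2) + card ?P * ln N"
    proof -
      \<comment> \<open>A prime above \<open>(n + 1) div 2\<close> exceeds (n + 1) / 2 and hence N /
        4, so \<open>?R\<close> lies in \<open>?P\<close>.\<close>
      let ?Q = "{p. prime p \<and> p \<le> (n + 1) div 2}" and ?R = "{p. prime p \<and> (n + 1) div 2 < p \<and> p \<le> 2 * n}"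
      have "{p. prime p \<and> p \<le> 2 * n} = ?Q \<union> ?R" using n by auto
      then have "theta (2 * n) = theta ((n + 1) div 2) + (\<Sum>p\<in>?R. ln (real p))"
        unfolding theta_def by (simp, subst sum.union_disjoint) auto
      also have "(\<Sum>p\<in>?R. ln (real p)) \<le> (\<Sum>p\<in>?R. ln N)"
        using n by (intro sum_mono) (auto simp: prime_gt_0_nat)
      also have "\<dots> = card ?R * ln N" by simp
      also have "\<dots> \<le> card ?P * ln N"
      proof (intro mult_right_mono of_nat_mono card_mono finP)
        show "?R \<subseteq> ?P" using n by auto
      qed (use elim(1) in simp)
      finally show ?thesis by simp
    qed
    also have "theta ((n + 1) div 2) \<le> (n + 1) div 2 * ln 4" by (rule theta_le)
    also have "(n + 1) div 2 * ln 4 \<le> (n + 1) / 2 * ln (4::real)"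
      by (intro mult_right_mono) auto
    finally have "(real n - (n + 1) / 2) * ln 4 - ln N - sqrt N * (ln N / ln 2 + 1) * ln N \<le> card ?P * ln N"
      by (simp add: algebra_simps)
    moreover have "(N / 4 - 1) * ln 4 \<le> (real n - (n + 1) / 2) * ln 4"
      using n by (intro mult_right_mono) (auto simp: field_simps)
    ultimately have "N / 4 \<le> card ?P * ln N" using elim(2) by linarith
    then show ?case using elim(1) by (simp add: field_simps)
  qed
qed

section \<open>Products with coprime factors\<close>

lemma card_frequencies_le: "card {h. 0 < \<bar>h\<bar> \<and> \<bar>h\<bar> < 2 * int K} \<le> 4 * K"
proof -
  have "card {h. 0 < \<bar>h\<bar> \<and> \<bar>h\<bar> < 2 * int K} \<le> card {- 2 * int K..<2 * int K}"
    by (rule card_mono) auto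
  then show ?thesis by simp
qed

text \<open>The uncertainty inequality is applied for each x to the dilate of \<open>B\<close> by
  the inverse of x, then all x are combined by \<open>large_sieve\<close>. The constants are 900 =
  25 * 4 * 9 and 144 = 16 * 9, the 9 coming from K <= 9 m / L.\<close>

lemma card_missed_residues_le:
  fixes N L :: real and S :: int and X :: "int set"
  assumes L: "36 \<le> L" "L \<le> m" and NL: "72 * m \<le> N * L" and fin: "finite X"
    and X: "\<And>x. x \<in> X \<Longrightarrow> prime x \<and> N / 4 \<le> x \<and> x \<le> N \<and> coprime x (int m)"
  defines "B \<equiv> {a \<in> {0..<int m}. \<not> (\<exists>x\<in>X. \<exists>y. S + 1 \<le> y \<and> y \<le> S + L \<and> x * y mod int m = a)}"
  shows "card X * card B \<le> 900 * (m / L) * (144 * N / L + 2) * m"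
proof -
  have m: "m > 0" using L by (cases m) auto
  have "0 < N * L" using NL m by (smt (verit) of_nat_0_less_iff)
  then have N: "N > 0" using L by (simp add: zero_less_mult_iff)
  \<comment> \<open>Off an interval of radius L / 4 the geometric sum is at most 4 m / L, so K >= 8
    m / L gives 4 \<tau> <= K^2 with \<tau> = (4 m / L)^2.\<close>
  define K where "K = nat \<lceil>8 * m / L\<rceil>"
  have "8 * m / L > 0" using m L by simp
  then have K: "8 * m / L \<le> K" "K > 0" "K < 8 * m / L + 1" unfolding K_def by linarith+
  have "1 \<le> m / L" using L by simp
  then have K9: "K \<le> 9 * (m / L)" using K by simp
  let ?H = "{h. 0 < \<bar>h\<bar> \<and> \<bar>h\<bar> < 2 * int K}"
  have "\<exists>u. [x * u = 1] (mod int m)" if "x \<in> X" for x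
    using X[OF that] cong_solve_coprime_int by blast
  then obtain f where f: "\<And>x. x \<in> X \<Longrightarrow> [x * f x = 1] (mod int m)" by metis
  \<comment> \<open>The integers within \<open>r\<close> of \<open>c\<close> run from S + 1 to S + 2
    r + 1, inside the range of y, and r + 1 >= L / 4.\<close>
  define r where "r = (\<lfloor>L\<rfloor> - 1) div 2"
  define c where "c = S + 1 + r"
  have r: "L / 4 \<le> r + 1" "2 * r + 1 \<le> L"
    using L unfolding r_def by linarith+
  have "18 * (m / L) \<le> N / 4" using NL L by (simp add: field_simps)
  then have KN: "2 * K \<le> N / 4" using K9 by linarith
  have "36 * (m / L) \<le> m" using L mult_left_mono[of 36 L "real m"] by (simp add: field_simps)
  then have "real (4 * K) \<le> real m" using K9 by simp
  then have Km: "4 * K \<le> m" by (simp only: of_nat_le_iff)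
  have small: "(cmod (dirichlet m K (f x * a - c)))\<^sup>2 \<le> (4 * m / L)\<^sup>2" if x: "x \<in> X" and a: "a \<in> B" for x a
  proof -
    define t where "t = (f x * a - c) mod int m"
    have a': "0 \<le> a" "a < int m" using a by (auto simp: B_def)
    \<comment> \<open>If y near c were congruent to \<open>f x * a\<close>, multiplying by x would
      exhibit a as a product, against a being in \<open>B\<close>.\<close>
    have far: "\<not> (\<bar>y - c\<bar> \<le> r)" if "[y = f x * a] (mod int m)" for y
    proof
      assume y: "\<bar>y - c\<bar> \<le> r"
      have "[x * y = x * (f x * a)] (mod int m)" using that by (rule cong_mult[OF cong_refl])
      also have "x * (f x * a) = (x * f x) * a" by simp
      also have "[(x * f x) * a = 1 * a] (mod int m)" by (rule cong_mult[OF f[OF x] cong_refl])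
      finally have "x * y mod int m = a" using a' by (simp add: Cong.cong_def)
      moreover have "S + 1 \<le> y" using y by (simp add: c_def)
      moreover have "y \<le> S + L"
      proof -
        have "y \<le> S + (2 * r + 1)" using y by (simp add: c_def)
        then have "real_of_int y \<le> real_of_int (S + (2 * r + 1))" by (simp only: of_int_le_iff)
        then show ?thesis using r by simp
      qed
      ultimately show False using a x by (auto simp: B_def)
    qed
    have t: "0 \<le> t" "t < int m" using m by (simp_all add: t_def)
    have ct: "[c + t = f x * a] (mod int m)"
      by (simp add: t_def Cong.cong_def mod_add_right_eq)
    have 1: "L / 4 \<le> t"
    proof -
      have "\<not> t \<le> r" using far[OF ct] t by simp
      then show ?thesis using r by linarith
    qed
    \<comment> \<open>The representative on the other side of \<open>c\<close>, at distance m - t,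
      keeps \<open>t\<close> away from \<open>m\<close>.\<close>
    have "[c + t - int m = f x * a] (mod int m)"
      using ct by (simp add: Cong.cong_def)
    from far[OF this] have "\<not> int m - t \<le> r" using t by simp
    then have 2: "t \<le> m - L / 4" using r by linarith
    have "cmod (dirichlet m K (f x * a - c)) \<le> m / (L / 4)"
      using m L 1 2 unfolding t_def by (intro dirichlet_bound) auto
    then have "cmod (dirichlet m K (f x * a - c)) \<le> 4 * m / L" by (simp add: mult.commute)
    then show ?thesis by (intro power_mono) auto
  qed
  have finH: "finite ?H"
    by (rule finite_subset[of _ "{- 2 * int K..2 * int K}"]) auto
  have "card X * card B \<le> 25 * card ?H * (16 * K * N / m + 2) * m"
  proof (rule large_sieve[where f = f])
    show "m > 0" "finite ?H" "finite X" "B \<subseteq> {0..<int m}" using m finH fin by (auto simp: B_def)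
    show "card {(h, x) \<in> ?H \<times> X. h * f x mod int m = l} \<le> 16 * K * N / m + 2" for l
      using X f by (intro card_slopes_le m N fin KN Km) auto
    fix x assume "x \<in> X"
    then show "card B \<le> 5 * (\<Sum>h\<in>?H. cmod (fourier m B (h * f x)))"
    proof (intro card_le_sum_fourier)
      have "(8 * m / L)\<^sup>2 \<le> (real K)\<^sup>2" using K L by (intro power_mono) auto
      then show "4 * (4 * m / L)\<^sup>2 \<le> (real K)\<^sup>2" by (simp add: power_divide power_mult_distrib)
    qed (use small K in auto)
  qed
  also have "\<dots> \<le> 25 * (36 * (m / L)) * (144 * N / L + 2) * m"
  proof -
    have "real (card ?H) \<le> real (4 * K)" using card_frequencies_le[of K] by (simp only: of_nat_le_iff)
    then have 1: "real (25 * card ?H) \<le> 25 * (36 * (m / L))" using K9 by simp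
    have "16 * K * N / m \<le> 16 * (9 * (m / L)) * N / m"
      using K9 N by (intro divide_right_mono mult_right_mono) auto
    then have "real (16 * K) * N / m + 2 \<le> 144 * N / L + 2" using m by simp
    with 1 show ?thesis using N L m by (intro mult_right_mono mult_mono) auto
  qed
  finally show ?thesis by simp
qed

section \<open>Multiples, prime divisors and the choice of the primes\<close>

lemma card_multiples_interval_le:
  fixes x S :: int and L :: real
  assumes "x > 0"
  shows "finite {y. S + 1 \<le> y \<and> y \<le> S + L \<and> x dvd y}"
    and "0 \<le> L \<Longrightarrow> card {y. S + 1 \<le> y \<and> y \<le> S + L \<and> x dvd y} \<le> L / x + 1"
proof -
  let ?A = "{y. S + 1 \<le> y \<and> y \<le> S + L \<and> x dvd y}"
  have A: "?A \<subseteq> {S + 1..S + \<lfloor>L\<rfloor>}" by (auto simp: le_floor_iff) linarith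
  then show "finite ?A" by (rule finite_subset) simp
  assume L: "0 \<le> L"
  have "card ?A \<le> card {S div x<..(S + \<lfloor>L\<rfloor>) div x}"
  proof (rule card_inj_on_le)
    show "inj_on (\<lambda>y. y div x) ?A" using assms by (auto simp: inj_on_def)
    show "(\<lambda>y. y div x) ` ?A \<subseteq> {S div x<..(S + \<lfloor>L\<rfloor>) div x}"
    proof
      fix v assume "v \<in> (\<lambda>y. y div x) ` ?A"
      then obtain y where y: "y \<in> ?A" "v = y div x" by blast
      then have "y \<le> S + \<lfloor>L\<rfloor>" using A by auto
      then have "v \<le> (S + \<lfloor>L\<rfloor>) div x" unfolding y using assms by (intro zdiv_mono1) auto
      moreover have "S div x < v"
      proof -
        have "x * (S div x) \<le> S" using pos_mod_sign[OF assms, of S] minus_mod_eq_mult_div[of S x] by linarith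
        also have "S < x * v" using y by auto
        finally show ?thesis using assms by simp
      qed
      ultimately show "v \<in> {S div x<..(S + \<lfloor>L\<rfloor>) div x}" by simp
    qed
  qed simp
  then have "real (card ?A) \<le> real (nat ((S + \<lfloor>L\<rfloor>) div x - S div x))"
    by (simp only: of_nat_le_iff card_greaterThanAtMost_int)
  also have "\<dots> \<le> L / x + 1"
  proof -
    have "real_of_int ((S + \<lfloor>L\<rfloor>) div x) \<le> real_of_int (S + \<lfloor>L\<rfloor>) / x" by (rule real_of_int_div4)
    also have "\<dots> \<le> (S + L) / x" using assms by (intro divide_right_mono) auto
    also have "\<dots> = S / x + L / x" by (rule add_divide_distrib)
    finally have 1: "real_of_int ((S + \<lfloor>L\<rfloor>) div x) \<le> S / x + L / x" .
    have 2: "S / x - 1 \<le> S div x"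
      unfolding floor_divide_of_int_eq[of S x, where 'a = real, symmetric] by linarith
    have "0 \<le> L / x" using L assms by simp
    then show ?thesis using 1 2 by linarith
  qed
  finally show "card ?A \<le> L / x + 1" .
qed

text \<open>The product of the distinct prime factors is at least 2 to their number and at most m;
  then ln 2 >= 1/2.\<close>

lemma card_prime_divisors_le:
  assumes "m > 0"
  shows "card {p::nat. prime p \<and> p dvd m} \<le> 2 * ln m"
proof -
  have eq: "{p. prime p \<and> p dvd m} = prime_factors m"
    using assms by (auto simp: prime_factors_dvd)
  have "2 ^ card (prime_factors m) = (\<Prod>p\<in>prime_factors m. 2)" by simp
  also have "\<dots> \<le> (\<Prod>p\<in>prime_factors m. p ^ multiplicity p m)"
  proof (intro prod_mono conjI)
    fix p assume p: "p \<in> prime_factors m"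
    then have "2 \<le> p" using prime_ge_2_nat by auto
    moreover have "multiplicity p m \<ge> 1" using p by (simp add: prime_factors_multiplicity Suc_le_eq)
    ultimately show "2 \<le> p ^ multiplicity p m" using power_increasing[of 1 "multiplicity p m" p] by simp
  qed simp
  also have "\<dots> = m" using prime_factorization_nat[OF assms] by simp
  finally have "real (2 ^ card (prime_factors m)) \<le> real m" by (simp only: of_nat_le_iff)
  then have "ln (2 ^ card (prime_factors m)) \<le> ln (real m)" using assms by (subst ln_le_cancel_iff) auto
  then have "card (prime_factors m) * ln 2 \<le> ln (real m)" by (simp add: ln_realpow)
  moreover have "card (prime_factors m) * (1 / 2) \<le> card (prime_factors m) * ln (2::real)"
    using ln2_ge_two_thirds by (intro mult_left_mono) auto
  ultimately show ?thesis unfolding eq by simp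
qed

text \<open>Of at least N / (4 ln m) primes at most 2 ln m divide m. The set is trimmed because the
  pairs with x dividing y are counted in proportion to its size.\<close>

lemma ex_prime_set:
  "\<exists>M. \<forall>m::nat. \<forall>N::real. real m \<ge> M \<and> sqrt m \<le> N \<and> N \<le> m \<longrightarrow>
     (\<exists>X::int set. finite X \<and> (\<forall>x\<in>X. prime x \<and> N / 4 \<le> x \<and> x \<le> N \<and> coprime x (int m)) \<and>
        N / (8 * ln m) \<le> card X \<and> card X \<le> N / (4 * ln m))"
proof -
  obtain N0 :: real where N0: "\<And>N::real. N \<ge> N0 \<Longrightarrow> N / (4 * ln N) \<le> real (card {p::nat. prime p \<and> N / 4 \<le> p \<and> p \<le> N})"
    using eventually_card_primes_ge unfolding eventually_at_top_linorder by blast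
  \<comment> \<open>The last condition leaves room for the discarded primes and for rounding
    \<open>n\<close> up.\<close>
  have "\<forall>\<^sub>F t::real in at_top. t \<ge> 3 \<and> sqrt t \<ge> N0 \<and> sqrt t \<ge> 2 \<and> 2 * ln t + 1 \<le> sqrt t / (8 * ln t)"
    by (intro eventually_conj; real_asymp)
  then obtain M where M: "\<And>t. t \<ge> M \<Longrightarrow> t \<ge> 3 \<and> sqrt t \<ge> N0 \<and> sqrt t \<ge> 2 \<and> 2 * ln t + 1 \<le> sqrt t / (8 * ln t)"
    unfolding eventually_at_top_linorder by blast
  show ?thesis
  proof (intro exI[of _ M] allI impI; elim conjE)
    fix m :: nat and N :: real
    assume mM: "real m \<ge> M" and N: "sqrt m \<le> N" "N \<le> m"
    have m: "m \<ge> 3" "sqrt m \<ge> N0" "sqrt m \<ge> 2" "2 * ln m + 1 \<le> sqrt m / (8 * ln m)"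
      using M[OF mM] by auto
    have ln0: "ln m > 0" using m by simp
    let ?P = "{p::nat. prime p \<and> N / 4 \<le> p \<and> p \<le> N}" and ?D = "{p::nat. prime p \<and> p dvd m}"
    have finP: "finite ?P"
      by (rule finite_subset[of _ "{..nat \<lfloor>N\<rfloor>}"]) (auto simp: le_nat_floor)
    have finD: "finite ?D" using m by (intro finite_subset[of ?D "{..m}"]) (auto dest: dvd_imp_le)
    have big: "2 * ln m + 1 \<le> N / (8 * ln m)"
      using m(4) divide_right_mono[OF N(1), of "8 * ln m"] ln0 by simp
    have "N / (4 * ln m) \<le> N / (4 * ln N)"
      using N m by (intro divide_left_mono) auto
    also have "\<dots> \<le> card ?P" using N m by (intro N0) auto
    finally have P: "N / (4 * ln m) \<le> card ?P" .
    define n where "n = nat \<lceil>N / (8 * ln m)\<rceil>"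
    have n: "N / (8 * ln m) \<le> n" "n \<le> N / (8 * ln m) + 1"
      using big ln0 unfolding n_def by linarith+
    have half: "N / (4 * ln m) = 2 * (N / (8 * ln m))" by simp
    have "card ?P - card ?D \<le> card (?P - ?D)" using finD by (rule diff_card_le_card_Diff)
    then have "real (card ?P) - real (card ?D) \<le> real (card (?P - ?D))" by linarith
    moreover have "card ?D \<le> 2 * ln m" using m by (intro card_prime_divisors_le) simp
    ultimately have "real n \<le> real (card (?P - ?D))" using P n big half by linarith
    then have "n \<le> card (?P - ?D)" by simp
    then obtain Y where Y: "Y \<subseteq> ?P - ?D" "card Y = n" and "finite Y"
      by (rule obtain_subset_with_card_n)
    show "\<exists>X::int set. finite X \<and> (\<forall>x\<in>X. prime x \<and> N / 4 \<le> x \<and> x \<le> N \<and> coprime x (int m)) \<and>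
        N / (8 * ln m) \<le> card X \<and> card X \<le> N / (4 * ln m)"
    proof (intro exI[of _ "int ` Y"] conjI ballI)
      show "finite (int ` Y)" using \<open>finite Y\<close> by simp
      have "card (int ` Y) = n" using Y(2) by (simp add: card_image)
      then show "N / (8 * ln m) \<le> card (int ` Y)" "card (int ` Y) \<le> N / (4 * ln m)"
        using n big half ln0 by linarith+
      fix x assume "x \<in> int ` Y"
      then obtain p where p: "x = int p" "prime p" "N / 4 \<le> p" "p \<le> N" "\<not> p dvd m" using Y by auto
      then show "prime x" "N / 4 \<le> x" "x \<le> N" by auto
      show "coprime x (int m)" using p by (simp add: prime_imp_coprime)
    qed
  qed
qed

text \<open>This secures L <= m when D w <= ln m, since then L <= sqrt m (ln m)^2.\<close>

lemma ln_square_le_sqrt: "\<exists>M\<ge>3. \<forall>t::real. t \<ge> M \<longrightarrow> (ln t)\<^sup>2 \<le> sqrt t"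
proof -
  have "\<forall>\<^sub>F t::real in at_top. t \<ge> 3 \<and> (ln t)\<^sup>2 \<le> sqrt t"
    by (intro eventually_conj; real_asymp)
  then obtain M where "\<And>t. t \<ge> M \<Longrightarrow> t \<ge> 3 \<and> (ln t)\<^sup>2 \<le> sqrt t"
    unfolding eventually_at_top_linorder by blast
  then show ?thesis by (intro exI[of _ M]) auto
qed

lemma one_le_sqrt_div_totient:
  assumes "m > 0"
  shows "1 \<le> sqrt (real m / real (totient m))"
proof -
  have "totient m > 0" "totient m \<le> m" using assms totient_le by auto
  then have "1 \<le> real m / real (totient m)" by simp
  then show ?thesis by simp
qed

lemma coprime_product_residues_subset:
  "m > 0 \<Longrightarrow> coprime_product_residues m N S D \<subseteq> {0..<int m}"
  by (auto simp: coprime_product_residues_def)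

text \<open>A residue outside the set is either missed by all products (\<open>B\<close>) or comes
  from a pair with x dividing y (\<open>R\<close>). The constant is 1051200 = 8 * 900 * (144 +
  2).\<close>

lemma card_coprime_product_residues_ge:
  fixes N D :: real
  assumes M: "\<And>t. t \<ge> M \<Longrightarrow> t \<ge> 3 \<and> (ln t)\<^sup>2 \<le> sqrt t"
    and fin: "finite X"
    and X: "\<And>x. x \<in> X \<Longrightarrow> prime x \<and> N / 4 \<le> x \<and> x \<le> N \<and> coprime x (int m)"
    and cX: "N / (8 * ln m) \<le> card X" "card X \<le> N / (4 * ln m)"
    and N: "sqrt m \<le> N" "N \<le> m" and m: "real m \<ge> M" and D: "72 \<le> D"
    and w: "w = sqrt (real m / real (totient m))" and Dw: "D * w \<le> ln m"
  shows "real m - real (card (coprime_product_residues m N S D)) \<le> (1051200 / D + 2 * (D / ln m * w)) * m"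
proof -
  define L where "L = D * real m powr (1 / 2) * w * ln m"
  have m3: "real m \<ge> 3" and lnsq: "(ln m)\<^sup>2 \<le> sqrt m" using M[OF m] by auto
  have m0: "m > 0" using m3 by (cases m) auto
  have w1: "w \<ge> 1"
    unfolding w by (rule one_le_sqrt_div_totient[OF m0])
  have Dw1: "D * 1 \<le> D * w" using w1 D by (intro mult_left_mono) auto
  then have ln1: "ln m \<ge> 72" and Dwge: "1 \<le> D * w" using Dw D by linarith+
  have sqm: "sqrt m * sqrt m = m" by simp
  have sq1: "sqrt m \<ge> 1" using m3 by simp
  have N0: "N > 0" using N sq1 by linarith
  have Leq: "L = sqrt m * (D * w) * ln m"
    using m0 by (simp add: L_def powr_half_sqrt)
  have L36: "36 \<le> L"
  proof -
    have "1 * (72 * 1) * 72 \<le> sqrt m * (D * w) * ln m"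
      using sq1 D w1 ln1 by (intro mult_mono) auto
    then show ?thesis by (simp add: Leq)
  qed
  have Lm: "L \<le> m"
  proof -
    have "L \<le> sqrt m * ln m * ln m"
      unfolding Leq using Dw ln1 by (intro mult_right_mono mult_left_mono) auto
    also have "\<dots> = sqrt m * (ln m)\<^sup>2" by (simp add: power2_eq_square)
    also have "\<dots> \<le> sqrt m * sqrt m" using lnsq by (intro mult_left_mono) auto
    finally show ?thesis by simp
  qed
  \<comment> \<open>This and \<open>LLD\<close> below bound the two terms m ln m / (N L) and m ln m
    / L^2 of the estimate for \<open>B\<close> by 1 / D.\<close>
  have NLD: "D * (m * ln m) \<le> N * L"
  proof -
    have "D * (m * ln m) = sqrt m * (sqrt m * D * ln m)"
      by (subst sqm[symmetric]) (simp only: mult_ac)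
    also have "\<dots> \<le> N * (sqrt m * (D * w) * ln m)"
      using N Dw1 D ln1 N0 by (intro mult_mono) auto
    finally show ?thesis by (simp only: Leq)
  qed
  have "72 * (real m * 1) \<le> D * (m * ln m)" using D ln1 by (intro mult_mono) auto
  then have NL: "72 * real m \<le> N * L" using NLD by simp
  have LLD: "D * (m * ln m) \<le> L * L"
  proof -
    have "D * (m * ln m) = sqrt m * D * 1 * (sqrt m * 1 * ln m)"
      by (subst sqm[symmetric]) (simp only: mult_ac mult_1_right mult_1_left)
    also have "\<dots> \<le> sqrt m * (D * w) * ln m * (sqrt m * (D * w) * ln m)"
      using Dw1 Dwge D ln1 by (intro mult_mono) auto
    finally show ?thesis by (simp only: Leq)
  qed
  define B where "B = {a \<in> {0..<int m}. \<not> (\<exists>x\<in>X. \<exists>y. S + 1 \<le> y \<and> y \<le> S + L \<and> x * y mod int m = a)}"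
  define Y where "Y x = {y. S + 1 \<le> y \<and> y \<le> S + L \<and> x dvd y}" for x :: int
  define R where "R = (\<Union>x\<in>X. (\<lambda>y. x * y mod int m) ` Y x)"
  let ?A = "coprime_product_residues m N S D"
  have finY: "finite (Y x)" if "x \<in> X" for x
    unfolding Y_def using X[OF that] prime_gt_0_int by (intro card_multiples_interval_le) auto
  have finA: "finite ?A" by (rule finite_subset[OF coprime_product_residues_subset[OF m0]]) simp
  have finR: "finite R" using finY fin by (auto simp: R_def)
  have finB: "finite B" by (rule finite_subset[of B "{0..<int m}"]) (auto simp: B_def)
  have cover: "{0..<int m} \<subseteq> ?A \<union> (B \<union> R)"
  proof
    fix a assume a: "a \<in> {0..<int m}"
    show "a \<in> ?A \<union> (B \<union> R)"
    proof (cases "a \<in> B")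
      case False
      then obtain x y where xy: "x \<in> X" "S + 1 \<le> y" "y \<le> S + L" "x * y mod int m = a"
        using a by (auto simp: B_def)
      show ?thesis
      proof (cases "x dvd y")
        case True
        then have "a \<in> R" using xy by (auto simp: R_def Y_def)
        then show ?thesis by simp
      next
        case False
        then have "coprime x y" using X[OF xy(1)] by (simp add: prime_imp_coprime)
        then have "a \<in> ?A"
          unfolding coprime_product_residues_def mem_Collect_eq L_def[unfolded w, symmetric]
          using xy X[OF xy(1)] by - (rule exI[of _ x], rule exI[of _ y], auto)
        then show ?thesis by simp
      qed
    qed simp
  qed
  have "m = card {0..<int m}" by simp
  also have "\<dots> \<le> card (?A \<union> (B \<union> R))" using cover finA finB finR by (intro card_mono) auto
  also have "\<dots> \<le> card ?A + (card B + card R)"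
    by (meson add_left_mono card_Un_le order_trans)
  finally have mle: "real m - real (card ?A) \<le> real (card B) + real (card R)" by linarith
  have "card B \<le> 1051200 / D * m"
  proof -
    have "N / (8 * ln m) * card B \<le> real (card X) * real (card B)"
      using cX by (intro mult_right_mono) auto
    also have "\<dots> \<le> 900 * (m / L) * (144 * N / L + 2) * m"
      using card_missed_residues_le[OF L36 Lm NL fin X] unfolding B_def of_nat_mult .
    finally have "8 * ln m / N * (N / (8 * ln m) * card B)
        \<le> 8 * ln m / N * (900 * (m / L) * (144 * N / L + 2) * m)"
      using N0 ln1 by (intro mult_left_mono) auto
    also have "8 * ln m / N * (N / (8 * ln m) * card B) = card B" using N0 ln1 by simp
    also have "8 * ln m / N * (900 * (m / L) * (144 * N / L + 2) * m)
        = 7200 * m * (144 * (m * ln m / (L * L)) + 2 * (m * ln m / (N * L)))"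
      using N0 ln1 L36 by (simp add: field_simps)
    also have "\<dots> \<le> 7200 * m * (144 * (1 / D) + 2 * (1 / D))"
    proof -
      have "m * ln m / (L * L) \<le> 1 / D" "m * ln m / (N * L) \<le> 1 / D"
        using LLD NLD D L36 N0 by (simp_all add: field_simps)
      then show ?thesis by (intro mult_left_mono add_mono) auto
    qed
    finally show ?thesis by simp
  qed
  moreover have "card R \<le> 2 * (D / ln m * w) * m"
  proof -
    have "card R \<le> (\<Sum>x\<in>X. card ((\<lambda>y. x * y mod int m) ` Y x))"
      unfolding R_def by (rule card_UN_le[OF fin])
    also have "\<dots> \<le> (\<Sum>x\<in>X. card (Y x))" by (intro sum_mono card_image_le finY)
    finally have "real (card R) \<le> (\<Sum>x\<in>X. real (card (Y x)))" by (simp flip: of_nat_sum)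
    also have "\<dots> \<le> (\<Sum>x\<in>X. L / (N / 4) + 1)"
    proof (rule sum_mono)
      fix x assume "x \<in> X"
      then have x: "x > 0" "N / 4 \<le> x" using X prime_gt_0_int by auto
      have "real (card (Y x)) \<le> L / x + 1"
        unfolding Y_def using x L36 by (intro card_multiples_interval_le) auto
      also have "\<dots> \<le> L / (N / 4) + 1"
        using x L36 N0 by (intro add_mono divide_left_mono) auto
      finally show "real (card (Y x)) \<le> L / (N / 4) + 1" .
    qed
    also have "\<dots> = card X * (L / (N / 4) + 1)" by simp
    also have "\<dots> \<le> N / (4 * ln m) * (L / (N / 4) + 1)"
      using cX L36 N0 by (intro mult_right_mono) auto
    also have "\<dots> = (L + N / 4) / ln m" using N0 ln1 by (simp add: divide_simps)
    also have "\<dots> \<le> (2 * m) / ln m" using Lm N N0 ln1 by (intro divide_right_mono) auto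
    \<comment> \<open>The factor D w >= 1 brings the bound O(m / ln m) into the shape of the second
      error term.\<close>
    also have "\<dots> \<le> (2 * m) / ln m * (D * w)"
      using mult_left_mono[of 1 "D * w" "(2 * m) / ln m"] Dw1 D ln1 by simp
    finally show ?thesis by (simp add: mult_ac)
  qed
  ultimately show ?thesis using mle by (simp add: ring_distribs)
qed

text \<open>If C times the error term is at least 1, the bound is trivial, as the deficit is at most
  m. Otherwise D > C and C D w < ln m, the range of
  \<open>card_coprime_product_residues_ge\<close>.\<close>

lemma coprime_product_residues_deficit:
  "\<exists>C\<ge>0. \<forall>m S N D. 2 \<le> m \<and> sqrt (real m) \<le> N \<and> N \<le> real m \<and> 0 < D \<longrightarrow>
     m - real (card (coprime_product_residues m N S D)) \<le>
       C * (inverse D + D / ln m * sqrt (real m / real (totient m))) * m"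
proof -
  obtain M1 where M1: "\<And>(m::nat) (N::real). real m \<ge> M1 \<Longrightarrow> sqrt m \<le> N \<Longrightarrow> N \<le> m \<Longrightarrow>
     \<exists>X::int set. finite X \<and> (\<forall>x\<in>X. prime x \<and> N / 4 \<le> x \<and> x \<le> N \<and> coprime x (int m)) \<and>
        N / (8 * ln m) \<le> card X \<and> card X \<le> N / (4 * ln m)"
    using ex_prime_set by metis
  obtain M2 where M2: "M2 \<ge> 3" "\<And>t. t \<ge> M2 \<Longrightarrow> (ln t)\<^sup>2 \<le> sqrt t"
    using ln_square_le_sqrt by blast
  define M where "M = max M1 M2"
  \<comment> \<open>The entry \<open>ln M\<close> disposes of small m: in the nontrivial case ln M
    <= C < D <= D w <= ln m.\<close>
  define C where "C = max (1051200::real) (ln M)"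
  have M3: "M \<ge> 3" using M2 by (simp add: M_def)
  have C: "C \<ge> 1051200" "C \<ge> ln M" by (simp_all add: C_def)
  have main: "m - real (card (coprime_product_residues m N S D)) \<le>
       C * (inverse D + D / ln m * sqrt (real m / real (totient m))) * m"
    if asm: "2 \<le> m" "sqrt (real m) \<le> N" "N \<le> real m" "0 < D" for m S N D
  proof -
    define w where "w = sqrt (real m / real (totient m))"
    have w1: "w \<ge> 1"
      unfolding w_def using asm by (intro one_le_sqrt_div_totient) simp
    have ln0: "ln m > 0" using asm by simp
    define s where "s = inverse D + D / ln m * w"
    have s: "inverse D \<le> s" "D / ln m * w \<le> s" using w1 ln0 asm by (simp_all add: s_def)
    have "m - real (card (coprime_product_residues m N S D)) \<le> C * s * m"
    proof (cases "1 \<le> C * s")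
      case True
      have "m - real (card (coprime_product_residues m N S D)) \<le> (1::real) * real m" by simp
      also have "\<dots> \<le> C * s * m" using True by (intro mult_right_mono) auto
      finally show ?thesis .
    next
      case False
      have "C * inverse D \<le> C * s" "C * (D / ln m * w) \<le> C * s"
        using s C by (intro mult_left_mono; simp)+
      then have "C * inverse D < 1" "C * (D / ln m * w) < 1" using False by linarith+
      then have D: "C < D" and Dw: "C * (D * w) < ln m"
        using asm ln0 by (simp_all add: field_simps)
      have Dw1: "D * 1 \<le> D * w" using w1 asm by (intro mult_left_mono) auto
      have "1 * (D * w) \<le> C * (D * w)" using C w1 asm by (intro mult_right_mono) auto
      then have Dw': "D * w \<le> ln m" using Dw by linarith
      then have "ln M \<le> ln m" using C D Dw1 by linarith
      then have mM: "M \<le> m" using M3 asm by (subst (asm) ln_le_cancel_iff) auto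
      then obtain X :: "int set" where X: "finite X"
        "\<And>x. x \<in> X \<Longrightarrow> prime x \<and> N / 4 \<le> x \<and> x \<le> N \<and> coprime x (int m)"
        "N / (8 * ln m) \<le> card X" "card X \<le> N / (4 * ln m)"
        using M1[of m N] asm unfolding M_def by auto
      have Mt: "t \<ge> 3 \<and> (ln t)\<^sup>2 \<le> sqrt t" if "t \<ge> M" for t
        using that M2(1) M2(2)[of t] by (auto simp: M_def)
      have "m - real (card (coprime_product_residues m N S D)) \<le> (1051200 / D + 2 * (D / ln m * w)) * m"
        by (rule card_coprime_product_residues_ge[OF Mt X asm(2,3) mM _ w_def Dw'])
           (use D C in auto)
      also have "\<dots> \<le> (C * inverse D + C * (D / ln m * w)) * m"
        using C asm w1 ln0 by (intro mult_right_mono add_mono) (auto simp: divide_inverse)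
      also have "\<dots> = C * s * m" by (simp add: s_def ring_distribs)
      finally show ?thesis .
    qed
    then show ?thesis by (simp add: s_def w_def)
  qed
  show ?thesis using C main by (intro exI[of _ C]) auto
qed

theorem theorem3:
  "\<exists>\<epsilon>\<^sub>0 > (0::real). \<forall>\<epsilon>::real. 0 < \<epsilon> \<and> \<epsilon> < \<epsilon>\<^sub>0 \<longrightarrow>
     (\<exists>C > (0::real). \<forall>\<Delta> :: nat \<Rightarrow> real.
        (\<forall>m \<ge> 1. \<Delta> m > 0) \<and> filterlim \<Delta> at_top at_top \<longrightarrow>
        (\<forall>(m::nat) (S::int) (N::real).
           2 \<le> m \<and> real m powr (1 / (2 - \<epsilon>)) \<le> N \<and> N \<le> real m \<longrightarrow>
           (\<exists>E\<^sub>1 E\<^sub>2 :: real.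
              \<bar>E\<^sub>1\<bar> \<le> C * inverse (\<Delta> m) \<and>
              \<bar>E\<^sub>2\<bar> \<le> C * (\<Delta> m / ln (real m) * sqrt (real m / real (totient m))) \<and>
              real (card (coprime_product_residues m N S (\<Delta> m))) = (1 + E\<^sub>1 + E\<^sub>2) * real m)))"
proof -
  obtain C0 where C0: "C0 \<ge> 0" and deficit: "\<And>m S N D. 2 \<le> m \<Longrightarrow> sqrt (real m) \<le> N \<Longrightarrow> N \<le> real m \<Longrightarrow> 0 < D \<Longrightarrow>
     m - real (card (coprime_product_residues m N S D)) \<le>
       C0 * (inverse D + D / ln m * sqrt (real m / real (totient m))) * m"
    using coprime_product_residues_deficit by metis
  define C where "C = C0 + 1"
  have C: "C > 0" "C0 \<le> C" using C0 by (simp_all add: C_def)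
  have "\<exists>E\<^sub>1 E\<^sub>2 :: real. \<bar>E\<^sub>1\<bar> \<le> C * inverse D \<and>
      \<bar>E\<^sub>2\<bar> \<le> C * (D / ln (real m) * sqrt (real m / real (totient m))) \<and>
      real (card (coprime_product_residues m N S D)) = (1 + E\<^sub>1 + E\<^sub>2) * real m"
    if \<epsilon>: "0 < \<epsilon>" "\<epsilon> < 1" and D: "D > 0" and m: "2 \<le> m"
      and N: "real m powr (1 / (2 - \<epsilon>)) \<le> N" "N \<le> real m"
    for \<epsilon> D N :: real and m :: nat and S :: int
  proof -
    let ?c = "real (card (coprime_product_residues m N S D))"
    define a where "a = C * inverse D"
    define b where "b = C * (D / ln (real m) * sqrt (real m / real (totient m)))"
    have ab: "a \<ge> 0" "b \<ge> 0" using C D m by (simp_all add: a_def b_def)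
    \<comment> \<open>The range of N enters through N >= sqrt m, so one constant serves every
      \<epsilon> in (0, 1).\<close>
    have "real m powr (1 / 2) \<le> real m powr (1 / (2 - \<epsilon>))"
      using \<epsilon> m by (intro powr_mono divide_left_mono) auto
    then have "sqrt m \<le> N" using N m by (simp add: powr_half_sqrt)
    then have "m - ?c \<le> C0 * (inverse D + D / ln m * sqrt (real m / real (totient m))) * m"
      by (rule deficit[OF m _ N(2) D])
    also have "\<dots> \<le> C * (inverse D + D / ln m * sqrt (real m / real (totient m))) * m"
      using C D m by (intro mult_right_mono) auto
    also have "\<dots> = (a + b) * m" by (simp add: a_def b_def ring_distribs)
    finally have "m - ?c \<le> (a + b) * m" .
    define t where "t = 1 - ?c / m"
    have t1: "t \<le> a + b" using \<open>m - ?c \<le> (a + b) * m\<close> m by (simp add: t_def field_simps)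
    have "card (coprime_product_residues m N S D) \<le> card {0..<int m}"
      using m by (intro card_mono coprime_product_residues_subset) auto
    then have t0: "0 \<le> t" using m by (simp add: t_def field_simps)
    show ?thesis
    \<comment> \<open>The relative deficit satisfies 0 <= t <= a + b: the first error takes as much
      of it as \<open>a\<close> allows, and the remainder is at most \<open>b\<close>.\<close>
    proof (rule exI[of _ "- min t a"], rule exI[of _ "- (t - min t a)"], intro conjI)
      show "\<bar>- min t a\<bar> \<le> C * inverse D" using ab t0 by (simp flip: a_def)
      show "\<bar>- (t - min t a)\<bar> \<le> C * (D / ln (real m) * sqrt (real m / real (totient m)))"
        using ab t1 unfolding b_def[symmetric] by (simp add: min_def)
      show "?c = (1 + - min t a + - (t - min t a)) * m" using m by (simp add: t_def field_simps)
    qed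
  qed
  note expansion = this
  show ?thesis
  proof (rule exI[of _ 1], intro conjI allI impI)
    fix \<epsilon> :: real assume "0 < \<epsilon> \<and> \<epsilon> < 1"
    then show "\<exists>C > (0::real). \<forall>\<Delta> :: nat \<Rightarrow> real.
        (\<forall>m \<ge> 1. \<Delta> m > 0) \<and> filterlim \<Delta> at_top at_top \<longrightarrow>
        (\<forall>(m::nat) (S::int) (N::real).
           2 \<le> m \<and> real m powr (1 / (2 - \<epsilon>)) \<le> N \<and> N \<le> real m \<longrightarrow>
           (\<exists>E\<^sub>1 E\<^sub>2 :: real.
              \<bar>E\<^sub>1\<bar> \<le> C * inverse (\<Delta> m) \<and>
              \<bar>E\<^sub>2\<bar> \<le> C * (\<Delta> m / ln (real m) * sqrt (real m / real (totient m))) \<and>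
              real (card (coprime_product_residues m N S (\<Delta> m))) = (1 + E\<^sub>1 + E\<^sub>2) * real m))"
      using C by - (rule exI[of _ C], intro conjI allI impI expansion[where \<epsilon> = \<epsilon>], auto)
  qed simp
qed

end
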